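(* The bilinear form $\mathscr A$ on $\mathbb V_{1,1}\times\mathbb V_{1,1}$, $$\mathscr A[W,V]:=(\nabla_\Gamma\mathbf w,\nabla_\Gamma\mathbf v)+(\nabla_\Gamma w,\nabla_\Gamma v)+(\nabla_\Gamma w,\mathbf v)-(\mathbf R\mathbf w,\nabla_\Gamma v),$$ is continuous and satisfies a Gårding inequality: for all $V,W\in\mathbb V_{1,1}$, $$|\mathscr A[W,V]|\le C_{\mathscr A}\|W\|_{1,1}\|V\|_{1,1},\qquad c_{\mathscr A,1}\|W\|_{1,1}^2-c_{\mathscr A,2}\|W\|_{0,0}^2\le\mathscr A[W,W],$$ where $c_{\mathscr A,1},c_{\mathscr A,2},C_{\mathscr A}>0$ are defined as $$c_{\mathscr A,1}:=\tfrac12,\qquad c_{\mathscr A,2}:=\tfrac12\|\mathbf P-\mathbf R\|_{0,\infty}^2,\qquad C_{\mathscr A}:=1+C_{P,t}\max\{1,\|\mathbf R\|_{0,\infty}\}.$$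
   Context: $\Gamma\subset\mathbb R^{d+1}$, $d\ge 2$, is a compact connected $d$-dimensional hypersurface without boundary of class $C^3$, with outward unit normal $\mathbf n$ and $\mathbf P=\mathbf I-\mathbf n\otimes\mathbf n$. For a scalar function $v$, $\nabla_\Gamma v$ is the tangential gradient. For a vector field $\mathbf v=(v_i)_{i=1}^{d+1}$, $\nabla_\Gamma\mathbf v:=\mathbf P(\nabla_\Gamma^T v_i)_{i=1}^{d+1}$ (the matrix with rows $\nabla_\Gamma^T v_i$, multiplied on the left by $\mathbf P$) is the covariant gradient. $\mathbf W:=\nabla_\Gamma\mathbf n$ is the Weingarten map and $\mathbf R:=\mathrm{tr}(\mathbf W)\mathbf W-\mathbf W^2$. $(\cdot,\cdot)$ is the $L^2(\Gamma)$ inner product, $\|\cdot\|$ its norm; $\|\cdot\|_{0,\infty}$ is the $L^\infty(\Gamma)$-norm. $L^2_\#$ is the space of $L^2(\Gamma)$ functions with zero mean, $H^1_\#:=H^1(\Gamma)\cap L^2_\#$; $\mathbf L^2_t$ is the space of $\mathbf v\in L^2(\Gamma;\mathbb R^{d+1})$ with $\mathbf v\cdot\mathbf n=0$ a.e., $\mathbf H^1_t:=H^1(\Gamma;\mathbb R^{d+1})\cap\mathbf L^2_t$. $\mathbb V_{1,1}:=\mathbf H^1_t\times H^1_\#$, with elements written $V=(\mathbf v,v)$, $W=(\mathbf w,w)$ and norm $\|V\|_{1,1}=(\|\nabla_\Gamma\mathbf v\|^2+\|\nabla_\Gamma v\|^2)^{1/2}$; $\|V\|_{0,0}=(\|\mathbf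 v\|^2+\|v\|^2)^{1/2}$. $C_{P,t}>0$ is the Poincaré constant for tangential fields: $\|\mathbf v\|\le C_{P,t}\|\nabla_\Gamma\mathbf v\|$ for all $\mathbf v\in\mathbf H^1_t$.
   Formalization: The claim c_{A,2} > 0 fails when P = R almost everywhere (e.g. the unit sphere with d = 2, where c_{A,2} = 0); the formal statement proves c_{A,2} ≥ 0 always and c_{A,2} > 0 unless P = R a.e. *)

theory Defs
  imports "HOL-Analysis.Analysis" "HOL-Probability.Essential_Supremum"
begin

section \<open>Hausdorff measure and surface measure\<close>

text \<open>The \<open>d\<close>-dimensional Hausdorff measure, normalised so that it agrees with the
  \<open>d\<close>-dimensional area: a covering set of diameter \<open>\<rho>\<close> counts as a \<open>d\<close>-ball of radius
  \<open>\<rho> / 2\<close>. The case distinction on empty covering sets only matters for \<open>d = 0\<close>.\<close>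

definition hausdorff_pre :: "nat \<Rightarrow> real \<Rightarrow> 'a::metric_space set \<Rightarrow> ennreal" where
  "hausdorff_pre d \<delta> A =
     (INF E \<in> {E :: nat \<Rightarrow> 'a set. A \<subseteq> (\<Union>i. E i) \<and> (\<forall>i. bounded (E i) \<and> diameter (E i) \<le> \<delta>)}.
        \<Sum>i. if E i = {} then 0
            else ennreal (unit_ball_vol (real d) * (diameter (E i) / 2) ^ d))"

definition hausdorff_outer :: "nat \<Rightarrow> 'a::metric_space set \<Rightarrow> ennreal" where
  "hausdorff_outer d A = (SUP \<delta> \<in> {0<..}. hausdorff_pre d \<delta> A)"

text \<open>The outer measure is a metric outer measure, hence countably additive on the Borel sets
  (Caratheodory's criterion), so \<open>measure_of\<close> does not fall back to the null measure.\<close>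

definition hausdorff_measure :: "nat \<Rightarrow> 'a::metric_space measure" where
  "hausdorff_measure d = measure_of UNIV (sets borel) (hausdorff_outer d)"

definition surface_measure :: "(real^'n) set \<Rightarrow> (real^'n) measure" where
  "surface_measure \<Gamma> = restrict_space (hausdorff_measure (CARD('n) - 1)) \<Gamma>"


section \<open>Hypersurfaces\<close>

text \<open>On open sets: \<open>f\<close> is \<open>k + 1\<close> times continuously differentiable iff it is differentiable
  and all its partial derivatives are \<open>k\<close> times continuously differentiable.\<close>

primrec Ck_on :: "nat \<Rightarrow> 'a::euclidean_space set \<Rightarrow> ('a \<Rightarrow> 'b::real_normed_vector) \<Rightarrow> bool" where
  "Ck_on 0 U f \<longleftrightarrow> continuous_on U f"
| "Ck_on (Suc k) U f \<longleftrightarrow>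
     (\<forall>x\<in>U. f differentiable (at x)) \<and>
     (\<forall>b\<in>Basis. Ck_on k U (\<lambda>x. frechet_derivative f (at x) b))"

text \<open>Locally a regular zero level set of a \<open>C\<^sup>k\<close> function. In particular such a set has no
  boundary points.\<close>

definition Ck_hypersurface :: "nat \<Rightarrow> (real^'n) set \<Rightarrow> bool" where
  "Ck_hypersurface k \<Gamma> \<longleftrightarrow>
     (\<forall>x\<in>\<Gamma>. \<exists>U (\<phi> :: real^'n \<Rightarrow> real).
        open U \<and> x \<in> U \<and> Ck_on k U \<phi> \<and> \<Gamma> \<inter> U = {y\<in>U. \<phi> y = 0} \<and>
        (\<forall>y\<in>U. frechet_derivative \<phi> (at y) \<noteq> (\<lambda>_. 0)))"

definition tangent_space :: "(real^'n) set \<Rightarrow> real^'n \<Rightarrow> (real^'n) set" where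
  "tangent_space \<Gamma> x =
     {v. \<exists>\<gamma>. \<gamma> 0 = x \<and> (\<forall>t::real. \<gamma> t \<in> \<Gamma>) \<and> (\<gamma> has_vector_derivative v) (at 0)}"

text \<open>\<open>inside \<Gamma>\<close> and \<open>outside \<Gamma>\<close> are the unions of the bounded and of the unbounded components of
  the complement of \<open>\<Gamma>\<close>. By the Jordan-Brouwer theorem, a compact connected hypersurface has
  exactly one such field \<open>n\<close> (up to its irrelevant values off \<open>\<Gamma>\<close>).\<close>

definition outward_unit_normal :: "(real^'n) set \<Rightarrow> (real^'n \<Rightarrow> real^'n) \<Rightarrow> bool" where
  "outward_unit_normal \<Gamma> n \<longleftrightarrow>
     (\<forall>x\<in>\<Gamma>. norm (n x) = 1 \<and>
        (\<forall>v\<in>tangent_space \<Gamma> x. n x \<bullet> v = 0) \<and>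
        (\<forall>\<^sub>F t in at_right 0. x + t *\<^sub>R n x \<in> outside \<Gamma> \<and> x - t *\<^sub>R n x \<in> inside \<Gamma>))"


section \<open>Classical tangential calculus\<close>

text \<open>The derivative along \<open>\<Gamma>\<close> (\<open>at x within \<Gamma>\<close>) is represented by a unique tangent vector, which
  is \<open>P\<close> applied to the gradient of any differentiable extension of \<open>f\<close>.\<close>

definition tangential_gradient :: "(real^'n) set \<Rightarrow> (real^'n \<Rightarrow> real) \<Rightarrow> real^'n \<Rightarrow> real^'n" where
  "tangential_gradient \<Gamma> f x =
     (THE g. g \<in> tangent_space \<Gamma> x \<and> (f has_derivative (\<lambda>h. g \<bullet> h)) (at x within \<Gamma>))"

definition tangent_proj :: "(real^'n \<Rightarrow> real^'n) \<Rightarrow> real^'n \<Rightarrow> real^'n^'n" where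
  "tangent_proj n x = mat 1 - (\<chi> i j. n x $ i * n x $ j)"

definition weingarten :: "(real^'n) set \<Rightarrow> (real^'n \<Rightarrow> real^'n) \<Rightarrow> real^'n \<Rightarrow> real^'n^'n" where
  "weingarten \<Gamma> n x = tangent_proj n x ** (\<chi> i. tangential_gradient \<Gamma> (\<lambda>y. n y $ i) x)"

definition ricci_map :: "(real^'n) set \<Rightarrow> (real^'n \<Rightarrow> real^'n) \<Rightarrow> real^'n \<Rightarrow> real^'n^'n" where
  "ricci_map \<Gamma> n x =
     trace (weingarten \<Gamma> n x) *\<^sub>R weingarten \<Gamma> n x - weingarten \<Gamma> n x ** weingarten \<Gamma> n x"


section \<open>Lebesgue and Sobolev spaces on \<open>\<Gamma>\<close>\<close>

text \<open>Elements of the function spaces are represented by functions on the ambient space, of which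
  only the values on \<open>\<Gamma>\<close> matter. For matrix-valued functions, \<open>\<bullet>\<close> and \<open>norm\<close> are the Frobenius
  inner product and norm.\<close>

definition L2 :: "(real^'n) set \<Rightarrow> (real^'n \<Rightarrow> 'b::euclidean_space) set" where
  "L2 \<Gamma> = {f. f \<in> borel_measurable (surface_measure \<Gamma>) \<and>
              integrable (surface_measure \<Gamma>) (\<lambda>x. (norm (f x))\<^sup>2)}"

definition L2_inner ::
  "(real^'n) set \<Rightarrow> (real^'n \<Rightarrow> 'b::euclidean_space) \<Rightarrow> (real^'n \<Rightarrow> 'b) \<Rightarrow> real" where
  "L2_inner \<Gamma> f g = (LINT x|surface_measure \<Gamma>. f x \<bullet> g x)"

definition L2_norm :: "(real^'n) set \<Rightarrow> (real^'n \<Rightarrow> 'b::euclidean_space) \<Rightarrow> real" where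
  "L2_norm \<Gamma> f = sqrt (L2_inner \<Gamma> f f)"

text \<open>The \<open>L\<^sup>\<infinity>\<close> norm of a matrix field, with the pointwise spectral norm. It is bounded by the
  variant with the pointwise Frobenius norm.\<close>

definition Linf_norm :: "(real^'n) set \<Rightarrow> (real^'n \<Rightarrow> real^'n^'n) \<Rightarrow> real" where
  "Linf_norm \<Gamma> A = real_of_ereal (esssup (surface_measure \<Gamma>) (\<lambda>x. ereal (onorm ((*v) (A x)))))"

text \<open>Weak tangential gradient, by integration by parts on the closed surface \<open>\<Gamma>\<close>: for \<open>C\<^sup>1\<close>
  functions, the integral of \<open>\<nabla>\<^sub>\<Gamma> f\<close> is that of \<open>f (tr W) n\<close>, applied here to \<open>f = v \<phi>\<close>. The
  weak gradient is unique up to null sets.\<close>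

definition is_weak_gradient ::
  "(real^'n) set \<Rightarrow> (real^'n \<Rightarrow> real^'n) \<Rightarrow> (real^'n \<Rightarrow> real) \<Rightarrow> (real^'n \<Rightarrow> real^'n) \<Rightarrow> bool" where
  "is_weak_gradient \<Gamma> n v g \<longleftrightarrow>
     v \<in> L2 \<Gamma> \<and> g \<in> L2 \<Gamma> \<and>
     (\<forall>\<phi> :: real^'n \<Rightarrow> real. Ck_on 1 UNIV \<phi> \<longrightarrow>
        (LINT x|surface_measure \<Gamma>. v x *\<^sub>R tangential_gradient \<Gamma> \<phi> x) =
        - (LINT x|surface_measure \<Gamma>. \<phi> x *\<^sub>R g x)
        + (LINT x|surface_measure \<Gamma>. (v x * \<phi> x * trace (weingarten \<Gamma> n x)) *\<^sub>R n x))"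

definition H1 :: "(real^'n) set \<Rightarrow> (real^'n \<Rightarrow> real^'n) \<Rightarrow> (real^'n \<Rightarrow> real) set" where
  "H1 \<Gamma> n = {v. \<exists>g. is_weak_gradient \<Gamma> n v g}"

definition weak_gradient ::
  "(real^'n) set \<Rightarrow> (real^'n \<Rightarrow> real^'n) \<Rightarrow> (real^'n \<Rightarrow> real) \<Rightarrow> real^'n \<Rightarrow> real^'n" where
  "weak_gradient \<Gamma> n v = (SOME g. is_weak_gradient \<Gamma> n v g)"

definition covariant_gradient ::
  "(real^'n) set \<Rightarrow> (real^'n \<Rightarrow> real^'n) \<Rightarrow> (real^'n \<Rightarrow> real^'n) \<Rightarrow> real^'n \<Rightarrow> real^'n^'n" where
  "covariant_gradient \<Gamma> n v x =
     tangent_proj n x ** (\<chi> i. weak_gradient \<Gamma> n (\<lambda>y. v y $ i) x)"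

definition H1_mean_zero :: "(real^'n) set \<Rightarrow> (real^'n \<Rightarrow> real^'n) \<Rightarrow> (real^'n \<Rightarrow> real) set" where
  "H1_mean_zero \<Gamma> n = {v \<in> H1 \<Gamma> n. (LINT x|surface_measure \<Gamma>. v x) = 0}"

definition H1_tangential ::
  "(real^'n) set \<Rightarrow> (real^'n \<Rightarrow> real^'n) \<Rightarrow> (real^'n \<Rightarrow> real^'n) set" where
  "H1_tangential \<Gamma> n =
     {v. (\<forall>i. (\<lambda>x. v x $ i) \<in> H1 \<Gamma> n) \<and> (AE x in surface_measure \<Gamma>. v x \<bullet> n x = 0)}"

definition V11 ::
  "(real^'n) set \<Rightarrow> (real^'n \<Rightarrow> real^'n) \<Rightarrow> ((real^'n \<Rightarrow> real^'n) \<times> (real^'n \<Rightarrow> real)) set" where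
  "V11 \<Gamma> n = H1_tangential \<Gamma> n \<times> H1_mean_zero \<Gamma> n"

fun norm11 ::
  "(real^'n) set \<Rightarrow> (real^'n \<Rightarrow> real^'n) \<Rightarrow> (real^'n \<Rightarrow> real^'n) \<times> (real^'n \<Rightarrow> real) \<Rightarrow> real" where
  "norm11 \<Gamma> n (vv, v) =
     sqrt ((L2_norm \<Gamma> (covariant_gradient \<Gamma> n vv))\<^sup>2 + (L2_norm \<Gamma> (weak_gradient \<Gamma> n v))\<^sup>2)"

fun norm00 :: "(real^'n) set \<Rightarrow> (real^'n \<Rightarrow> real^'n) \<times> (real^'n \<Rightarrow> real) \<Rightarrow> real" where
  "norm00 \<Gamma> (vv, v) = sqrt ((L2_norm \<Gamma> vv)\<^sup>2 + (L2_norm \<Gamma> v)\<^sup>2)"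

definition poincare_constant :: "(real^'n) set \<Rightarrow> (real^'n \<Rightarrow> real^'n) \<Rightarrow> real \<Rightarrow> bool" where
  "poincare_constant \<Gamma> n C \<longleftrightarrow>
     C > 0 \<and> (\<forall>v\<in>H1_tangential \<Gamma> n. L2_norm \<Gamma> v \<le> C * L2_norm \<Gamma> (covariant_gradient \<Gamma> n v))"


section \<open>The bilinear form and its constants\<close>

fun form_A ::
  "(real^'n) set \<Rightarrow> (real^'n \<Rightarrow> real^'n) \<Rightarrow>
   (real^'n \<Rightarrow> real^'n) \<times> (real^'n \<Rightarrow> real) \<Rightarrow> (real^'n \<Rightarrow> real^'n) \<times> (real^'n \<Rightarrow> real) \<Rightarrow> real" where
  "form_A \<Gamma> n (ww, w) (vv, v) =
     L2_inner \<Gamma> (covariant_gradient \<Gamma> n ww) (covariant_gradient \<Gamma> n vv)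
     + L2_inner \<Gamma> (weak_gradient \<Gamma> n w) (weak_gradient \<Gamma> n v)
     + L2_inner \<Gamma> (weak_gradient \<Gamma> n w) vv
     - L2_inner \<Gamma> (\<lambda>x. ricci_map \<Gamma> n x *v ww x) (weak_gradient \<Gamma> n v)"

definition c_A1 :: real where
  "c_A1 = 1 / 2"

definition c_A2 :: "(real^'n) set \<Rightarrow> (real^'n \<Rightarrow> real^'n) \<Rightarrow> real" where
  "c_A2 \<Gamma> n = 1 / 2 * (Linf_norm \<Gamma> (\<lambda>x. tangent_proj n x - ricci_map \<Gamma> n x))\<^sup>2"

definition C_A :: "(real^'n) set \<Rightarrow> (real^'n \<Rightarrow> real^'n) \<Rightarrow> real \<Rightarrow> real" where
  "C_A \<Gamma> n C_P = 1 + C_P * max 1 (Linf_norm \<Gamma> (ricci_map \<Gamma> n))"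

end

theory Submission
  imports Defs
begin

text \<open>Analytically the result is Cauchy-Schwarz. For continuity (\<open>form_A_continuous\<close>) the undifferentiated
  tangential fields in the two coupling terms are controlled by the Poincare inequality. For the
  Garding inequality (\<open>form_A_Garding\<close>), the identity \<open>P w = w\<close> for tangential fields merges the two
  coupling terms of \<open>\<A>[W, W]\<close> into the inner product of \<open>(P - R) w\<close> with the gradient of the scalar
  component (\<open>form_A_coupling_eq\<close>), and Young's inequality absorbs one half of that gradient.

  The substance lies in the geometry that makes these estimates legitimate. For the
  \<open>L\<^sup>\<infinity>\<close> norms of \<open>R\<close> and \<open>P - R\<close> to be genuine bounds, and for the integrands to be integrable,
  these matrix fields must be measurable and essentially bounded. Both properties follow once \<open>n\<close>
  and the Weingarten map are continuous on the compact set \<open>\<Gamma>\<close>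
  (\<open>outward_normal_regular\<close>), which rests on three facts.

  \<^item> The tangent space, defined by velocities of curves in \<open>\<Gamma>\<close>, is the orthogonal complement of the
    gradient of a local defining function (\<open>tangent_space_defining_function\<close>). Therefore tangential
    gradients are unique, and they are the tangential part of the gradient of any extension
    (\<open>tangential_gradient_eq\<close>).
  \<^item> The outward normal is a normalised gradient up to sign, and the sign is locally constant because
    a sign change would connect the inside with the outside of \<open>\<Gamma>\<close> (\<open>outward_normal_sign_constant\<close>).
  \<^item> A nonvanishing gradient of a \<open>C\<^sup>3\<close> function, once normalised, has a continuous derivative, and so the
    components of the normal have continuous tangential gradients.\<close>

section \<open>Matrix products and the spectral norm\<close>

lemma bounded_bilinear_matrix_vector_mult:
  "bounded_bilinear ((*v) :: real^'n^'m \<Rightarrow> real^'n \<Rightarrow> real^'m)"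
  unfolding bilinear_conv_bounded_bilinear[symmetric] bilinear_def
  by (auto intro!: linearI simp: matrix_vector_right_distrib matrix_vector_mult_add_rdistrib
      matrix_vector_mult_scaleR scaleR_matrix_vector_assoc)

lemma bounded_bilinear_matrix_matrix_mult:
  "bounded_bilinear ((**) :: real^'n^'m \<Rightarrow> real^'k^'n \<Rightarrow> real^'k^'m)"
  unfolding bilinear_conv_bounded_bilinear[symmetric] bilinear_def
proof (intro conjI allI linearI)
  fix A B :: "real^'n^'m" and C D :: "real^'k^'n" and c :: real
  show "A ** (C + D) = A ** C + A ** D" by (rule matrix_add_ldistrib)
  show "A ** (c *\<^sub>R C) = c *\<^sub>R (A ** C)"
    by (simp add: vec_eq_iff matrix_matrix_mult_def sum_distrib_left mult.left_commute)
  show "(A + B) ** C = A ** C + B ** C"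
    by (simp add: vec_eq_iff matrix_matrix_mult_def distrib_right sum.distrib)
  show "(c *\<^sub>R A) ** C = c *\<^sub>R (A ** C)"
    by (simp add: vec_eq_iff matrix_matrix_mult_def sum_distrib_left mult.assoc)
qed

text \<open>The spectral norm is a seminorm dominated by a multiple of the Frobenius norm, hence
  Lipschitz. This makes the pointwise spectral norm of a continuous matrix field measurable and, on
  a compact set, bounded.\<close>

lemma continuous_on_onorm_matrix:
  "continuous_on UNIV (\<lambda>A :: real^'n^'m. onorm ((*v) A))"
proof -
  obtain K where K: "K > 0" "\<And>(A :: real^'n^'m) x. norm (A *v x) \<le> norm A * norm x * K"
    using bounded_bilinear.pos_bounded[OF bounded_bilinear_matrix_vector_mult] by blast
  have le: "onorm ((*v) A) - onorm ((*v) B) \<le> K * dist A B" for A B :: "real^'n^'m"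
  proof -
    have "(*v) A = (\<lambda>x. B *v x + (A - B) *v x)"
      by (auto simp: fun_eq_iff algebra_simps)
    then have "onorm ((*v) A) \<le> onorm ((*v) B) + onorm ((*v) (A - B))"
      by (metis onorm_triangle matrix_vector_mul_bounded_linear)
    also have "onorm ((*v) (A - B)) \<le> K * dist A B"
      by (rule onorm_bound) (use K in \<open>auto simp: dist_norm mult_ac intro: less_imp_le\<close>)
    finally show ?thesis by simp
  qed
  have "\<bar>onorm ((*v) A) - onorm ((*v) B)\<bar> \<le> K * dist A B" for A B :: "real^'n^'m"
    using le[of A B] le[of B A] by (simp add: dist_commute)
  then have "K-lipschitz_on UNIV (\<lambda>A :: real^'n^'m. onorm ((*v) A))"
    using K(1) by (intro lipschitz_onI) (auto simp: dist_real_def)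
  then show ?thesis
    by (rule lipschitz_on_continuous_on)
qed

section \<open>Square-integrable and essentially bounded fields on the surface\<close>

lemma space_surface_measure: "space (surface_measure \<Gamma>) = \<Gamma>"
  by (simp add: surface_measure_def space_restrict_space hausdorff_measure_def)

lemma AE_surface_measureI: "(\<And>x. x \<in> \<Gamma> \<Longrightarrow> P x) \<Longrightarrow> AE x in surface_measure \<Gamma>. P x"
  by (rule AE_I2) (simp add: space_surface_measure)

text \<open>The surface measure lives on the trace of the Borel sets, so measurability of the
  geometric fields will follow from their continuity along \<open>\<Gamma>\<close>.\<close>

lemma borel_measurable_surface_measureI:
  fixes f :: "real^'n \<Rightarrow> 'b::topological_space"
  assumes "continuous_on \<Gamma> f"
  shows "f \<in> borel_measurable (surface_measure \<Gamma>)"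
proof -
  have "sets (hausdorff_measure (CARD('n) - 1) :: (real^'n) measure) = sets borel"
    unfolding hausdorff_measure_def by (simp add: sigma_algebra.sets_measure_of_eq[OF sets.sigma_algebra_axioms[of borel, simplified]] flip: space_borel)
  then have "sets (surface_measure \<Gamma>) = sets (restrict_space borel \<Gamma>)"
    unfolding surface_measure_def by (rule sets_restrict_space_cong)
  then show ?thesis
    using borel_measurable_continuous_on_restrict[OF assms] by (metis measurable_cong_sets)
qed

lemma L2_measurable: "f \<in> L2 \<Gamma> \<Longrightarrow> f \<in> borel_measurable (surface_measure \<Gamma>)"
  and L2_integrable_norm_sq: "f \<in> L2 \<Gamma> \<Longrightarrow> integrable (surface_measure \<Gamma>) (\<lambda>x. (norm (f x))\<^sup>2)"
  by (auto simp: L2_def)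

lemma L2_norm_sq: "(L2_norm \<Gamma> f)\<^sup>2 = L2_inner \<Gamma> f f"
  by (simp add: L2_norm_def L2_inner_def)

lemma L2_norm_nonneg: "0 \<le> L2_norm \<Gamma> f"
  by (simp add: L2_norm_def L2_inner_def)

lemma L2_integrable_inner:
  fixes f g :: "real^'n \<Rightarrow> 'b::euclidean_space"
  assumes "f \<in> L2 \<Gamma>" "g \<in> L2 \<Gamma>"
  shows "integrable (surface_measure \<Gamma>) (\<lambda>x. f x \<bullet> g x)"
proof (rule Bochner_Integration.integrable_bound)
  show "integrable (surface_measure \<Gamma>) (\<lambda>x. (norm (f x))\<^sup>2 + (norm (g x))\<^sup>2)"
    using assms by (intro Bochner_Integration.integrable_add L2_integrable_norm_sq)
  show "(\<lambda>x. f x \<bullet> g x) \<in> borel_measurable (surface_measure \<Gamma>)"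
    using assms[THEN L2_measurable] by measurable
  have "\<bar>u \<bullet> v\<bar> \<le> (norm u)\<^sup>2 + (norm v)\<^sup>2" for u v :: 'b
  proof -
    have "\<bar>u \<bullet> v\<bar> \<le> norm u * norm v" by (rule Cauchy_Schwarz_ineq2)
    also have "\<dots> \<le> 2 * (norm u * norm v)" by simp
    also have "\<dots> \<le> (norm u)\<^sup>2 + (norm v)\<^sup>2" using sum_squares_bound[of "norm u" "norm v"] by simp
    finally show ?thesis .
  qed
  then show "AE x in surface_measure \<Gamma>. norm (f x \<bullet> g x) \<le> norm ((norm (f x))\<^sup>2 + (norm (g x))\<^sup>2)"
    by simp
qed

lemma discriminant_le_of_nonneg:
  fixes a b c :: real
  assumes q: "\<And>t. 0 \<le> a + 2 * t * c + t\<^sup>2 * b" and b: "0 \<le> b"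
  shows "c\<^sup>2 \<le> a * b"
proof (cases "b = 0")
  case True
  have "c = 0"
  proof (rule ccontr)
    assume "c \<noteq> 0"
    then show False using q[of "-(a + 1) / (2 * c)"] True by (simp add: field_simps)
  qed
  then show ?thesis using True by simp
next
  case False
  then have "b > 0" using b by simp
  then show ?thesis using q[of "- c / b"] by (simp add: field_simps power2_eq_square)
qed

text \<open>The quadratic polynomial \<open>t \<mapsto> \<parallel>f + t g\<parallel>\<^sup>2\<close> is nonnegative.\<close>

lemma L2_Cauchy_Schwarz:
  assumes f: "f \<in> L2 \<Gamma>" and g: "g \<in> L2 \<Gamma>"
  shows "\<bar>L2_inner \<Gamma> f g\<bar> \<le> L2_norm \<Gamma> f * L2_norm \<Gamma> g"
proof -
  note i = L2_integrable_inner[OF f f] L2_integrable_inner[OF f g] L2_integrable_inner[OF g g]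
  have "0 \<le> L2_inner \<Gamma> f f + 2 * t * L2_inner \<Gamma> f g + t\<^sup>2 * L2_inner \<Gamma> g g" for t
  proof -
    have "0 \<le> (LINT x|surface_measure \<Gamma>. (f x + t *\<^sub>R g x) \<bullet> (f x + t *\<^sub>R g x))"
      by (rule Bochner_Integration.integral_nonneg) simp
    also have "\<dots> = (LINT x|surface_measure \<Gamma>. f x \<bullet> f x + (2 * t * (f x \<bullet> g x) + t\<^sup>2 * (g x \<bullet> g x)))"
      by (intro Bochner_Integration.integral_cong)
         (auto simp: inner_add_left inner_add_right inner_commute power2_eq_square)
    also have "\<dots> = L2_inner \<Gamma> f f + 2 * t * L2_inner \<Gamma> f g + t\<^sup>2 * L2_inner \<Gamma> g g"
      using i unfolding L2_inner_def by simp
    finally show ?thesis .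
  qed
  then have "(L2_inner \<Gamma> f g)\<^sup>2 \<le> L2_inner \<Gamma> f f * L2_inner \<Gamma> g g"
    by (rule discriminant_le_of_nonneg) (simp add: L2_inner_def)
  also have "\<dots> = (L2_norm \<Gamma> f * L2_norm \<Gamma> g)\<^sup>2"
    by (simp add: power_mult_distrib L2_norm_sq)
  finally show ?thesis
    by (simp add: abs_le_square_iff[symmetric] abs_mult L2_norm_nonneg)
qed

lemma L2_of_bound:
  assumes f: "f \<in> L2 \<Gamma>" and h: "h \<in> borel_measurable (surface_measure \<Gamma>)"
    and le: "AE x in surface_measure \<Gamma>. norm (h x) \<le> K * norm (f x)" and K: "0 \<le> K"
  shows "h \<in> L2 \<Gamma>" "L2_norm \<Gamma> h \<le> K * L2_norm \<Gamma> f"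
proof -
  let ?M = "surface_measure \<Gamma>"
  have int: "integrable ?M (\<lambda>x. K\<^sup>2 * (norm (f x))\<^sup>2)"
    using L2_integrable_norm_sq[OF f] by simp
  have le2: "AE x in ?M. (norm (h x))\<^sup>2 \<le> K\<^sup>2 * (norm (f x))\<^sup>2"
    using le by eventually_elim (simp add: power_mono flip: power_mult_distrib)
  have ih: "integrable ?M (\<lambda>x. (norm (h x))\<^sup>2)"
    using h le2 by (intro Bochner_Integration.integrable_bound[OF int]) auto
  with h show "h \<in> L2 \<Gamma>" by (simp add: L2_def)
  have "(L2_norm \<Gamma> h)\<^sup>2 \<le> (LINT x|?M. K\<^sup>2 * (norm (f x))\<^sup>2)"
    unfolding L2_norm_sq L2_inner_def power2_norm_eq_inner[symmetric]
    by (rule integral_mono_AE[OF ih int le2])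
  also have "\<dots> = (K * L2_norm \<Gamma> f)\<^sup>2"
    by (simp add: power_mult_distrib L2_norm_sq L2_inner_def power2_norm_eq_inner)
  finally show "L2_norm \<Gamma> h \<le> K * L2_norm \<Gamma> f"
    by (rule power2_le_imp_le) (simp add: K L2_norm_nonneg)
qed

lemma L2_vec:
  fixes f :: "'k::finite \<Rightarrow> real^'n \<Rightarrow> 'b::euclidean_space"
  assumes "\<And>i. f i \<in> L2 \<Gamma>"
  shows "(\<lambda>x. \<chi> i. f i x) \<in> L2 \<Gamma>"
proof -
  note [measurable] = L2_measurable[OF assms]
  have "(\<lambda>x. (\<chi> i. f i x) \<bullet> b) \<in> borel_measurable (surface_measure \<Gamma>)" for b
    by (simp add: inner_vec_def)
  then have "(\<lambda>x. \<chi> i. f i x) \<in> borel_measurable (surface_measure \<Gamma>)"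
    by (subst borel_measurable_euclidean_space) blast
  moreover have "(norm (\<chi> i. f i x))\<^sup>2 = (\<Sum>i\<in>UNIV. (norm (f i x))\<^sup>2)" for x
    by (simp add: power2_norm_eq_inner inner_vec_def)
  ultimately show ?thesis
    using L2_integrable_norm_sq[OF assms] by (simp add: L2_def)
qed

text \<open>On a compact set a continuous factor is bounded, so it preserves square integrability. The
  bilinear map covers the matrix-matrix product in the covariant gradient as well as the
  matrix-vector product \<open>R w\<close> in the form.\<close>

lemma L2_continuous_mult:
  fixes A :: "real^'n \<Rightarrow> 'a::euclidean_space" and f :: "real^'n \<Rightarrow> 'b::euclidean_space"
    and B :: "'a \<Rightarrow> 'b \<Rightarrow> 'c::euclidean_space"
  assumes "compact \<Gamma>" and A: "continuous_on \<Gamma> A" and f: "f \<in> L2 \<Gamma>" and B: "bounded_bilinear B"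
  shows "(\<lambda>x. B (A x) (f x)) \<in> L2 \<Gamma>"
proof -
  obtain K where K: "K > 0" "\<And>a b. norm (B a b) \<le> norm a * norm b * K"
    using bounded_bilinear.pos_bounded[OF B] by blast
  have "bounded (A ` \<Gamma>)"
    using assms by (intro compact_imp_bounded compact_continuous_image)
  then obtain L where L: "L > 0" "\<And>x. x \<in> \<Gamma> \<Longrightarrow> norm (A x) \<le> L"
    unfolding bounded_pos by auto
  have *: "norm (B (A x) (f x)) \<le> (L * K) * norm (f x)" if "x \<in> \<Gamma>" for x
  proof -
    have "norm (B (A x) (f x)) \<le> norm (A x) * (norm (f x) * K)"
      using K(2)[of "A x" "f x"] by (simp add: mult_ac)
    also have "\<dots> \<le> L * (norm (f x) * K)"
      using L(2)[OF that] K(1) by (intro mult_right_mono) auto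
    finally show ?thesis by (simp add: mult_ac)
  qed
  show ?thesis
  proof (rule L2_of_bound(1)[OF f])
    show "(\<lambda>x. B (A x) (f x)) \<in> borel_measurable (surface_measure \<Gamma>)"
      by (rule borel_measurable_continuous_Pair[OF borel_measurable_surface_measureI[OF A] L2_measurable[OF f]])
         (intro bounded_bilinear.continuous_on[OF B] continuous_on_fst continuous_on_snd continuous_on_id)
    show "AE x in surface_measure \<Gamma>. norm (B (A x) (f x)) \<le> (L * K) * norm (f x)"
      using * by (rule AE_surface_measureI)
  qed (use K L in simp)
qed

text \<open>The norm is the conversion of an extended real, which sends infinite values to \<open>0\<close>. It
  bounds the field almost everywhere because a continuous field on a compact set has an essential
  supremum below \<open>\<infinity>\<close>; the value \<open>-\<infinity>\<close> arises only for the zero measure, for which every bound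
  holds almost everywhere.\<close>

lemma Linf_norm_bound:
  assumes "compact \<Gamma>" and A: "continuous_on \<Gamma> A"
  shows "0 \<le> Linf_norm \<Gamma> A"
    and "AE x in surface_measure \<Gamma>. onorm ((*v) (A x)) \<le> Linf_norm \<Gamma> A"
proof -
  let ?M = "surface_measure \<Gamma>" and ?o = "\<lambda>x. onorm ((*v) (A x))"
  let ?E = "esssup ?M (\<lambda>x. ereal (?o x))"
  have cont: "continuous_on \<Gamma> ?o"
    using continuous_on_compose2[OF continuous_on_onorm_matrix A] by simp
  have meas: "(\<lambda>x. ereal (?o x)) \<in> borel_measurable ?M"
    using borel_measurable_surface_measureI[OF cont] by simp
  have "bounded (?o ` \<Gamma>)"
    using assms cont by (intro compact_imp_bounded compact_continuous_image)
  then obtain K where K: "\<And>x. x \<in> \<Gamma> \<Longrightarrow> ?o x \<le> K"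
    unfolding bounded_pos by (auto simp: abs_le_iff)
  have fin: "?E \<le> ereal K"
    by (rule esssup_I[OF meas AE_surface_measureI]) (simp add: K)
  have ae: "AE x in ?M. ereal (?o x) \<le> ?E"
    by (rule esssup_AE)
  show "0 \<le> Linf_norm \<Gamma> A"
  proof (cases "emeasure ?M (space ?M) = 0")
    case True
    then show ?thesis by (simp add: Linf_norm_def esssup_zero_space[OF _ meas])
  next
    case False
    have "0 = esssup ?M (\<lambda>x. 0 :: ereal)" using esssup_const[OF False, of "0::ereal"] by simp
    also have "\<dots> \<le> ?E" by (rule esssup_mono) (auto simp: onorm_pos_le)
    finally show ?thesis by (simp add: Linf_norm_def real_of_ereal_pos)
  qed
  show "AE x in ?M. ?o x \<le> Linf_norm \<Gamma> A"
    using ae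
  proof eventually_elim
    case (elim x)
    with fin show ?case unfolding Linf_norm_def by (cases ?E) auto
  qed
qed

text \<open>The form in which \<open>L\<^sup>\<infinity>\<close> bounds enter the estimates: multiplication by a matrix field is
  bounded on \<open>L\<^sup>2\<close> by the \<open>L\<^sup>\<infinity>\<close> norm.\<close>

lemma Linf_norm_mult:
  assumes "compact \<Gamma>" and A: "continuous_on \<Gamma> A" and f: "f \<in> L2 \<Gamma>"
  shows "(\<lambda>x. A x *v f x) \<in> L2 \<Gamma>" "L2_norm \<Gamma> (\<lambda>x. A x *v f x) \<le> Linf_norm \<Gamma> A * L2_norm \<Gamma> f"
proof -
  show 1: "(\<lambda>x. A x *v f x) \<in> L2 \<Gamma>"
    by (rule L2_continuous_mult[OF assms bounded_bilinear_matrix_vector_mult])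
  show "L2_norm \<Gamma> (\<lambda>x. A x *v f x) \<le> Linf_norm \<Gamma> A * L2_norm \<Gamma> f"
  proof (rule L2_of_bound(2)[OF f L2_measurable[OF 1] _ Linf_norm_bound(1)[OF assms(1,2)]])
    show "AE x in surface_measure \<Gamma>. norm (A x *v f x) \<le> Linf_norm \<Gamma> A * norm (f x)"
      using Linf_norm_bound(2)[OF assms(1,2)]
    proof eventually_elim
      case (elim x)
      have "norm (A x *v f x) \<le> onorm ((*v) (A x)) * norm (f x)"
        by (rule onorm) simp
      also have "\<dots> \<le> Linf_norm \<Gamma> A * norm (f x)"
        by (rule mult_right_mono[OF elim]) simp
      finally show ?case .
    qed
  qed
qed


section \<open>Defining functions and tangent spaces\<close>

lemma inner_sum_Basis_of_linear:
  fixes F :: "'a::euclidean_space \<Rightarrow> real"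
  assumes "linear F"
  shows "(\<Sum>b\<in>Basis. F b *\<^sub>R b) \<bullet> h = F h"
proof -
  have "F h = F (\<Sum>b\<in>Basis. (h \<bullet> b) *\<^sub>R b)" by (simp add: euclidean_representation)
  also have "\<dots> = (\<Sum>b\<in>Basis. (h \<bullet> b) * F b)"
    by (simp add: linear_sum[OF assms] linear_scale[OF assms])
  finally show ?thesis by (simp add: inner_sum_left inner_commute[of h] mult.commute)
qed

text \<open>The last argument is the gradient of the defining function, carried along so that its
  continuity and later its derivative can be spoken of directly.\<close>

definition defining_function ::
  "'a::euclidean_space set \<Rightarrow> 'a set \<Rightarrow> ('a \<Rightarrow> real) \<Rightarrow> ('a \<Rightarrow> 'a) \<Rightarrow> bool" where
  "defining_function \<Gamma> U \<phi> g \<longleftrightarrow>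
     open U \<and> (\<forall>y\<in>U. (\<phi> has_derivative (\<lambda>h. g y \<bullet> h)) (at y) \<and> g y \<noteq> 0) \<and>
     continuous_on U g \<and> \<Gamma> \<inter> U = {y\<in>U. \<phi> y = 0}"

lemma defining_function_subset:
  "defining_function \<Gamma> U \<phi> g \<Longrightarrow> open V \<Longrightarrow> V \<subseteq> U \<Longrightarrow> defining_function \<Gamma> V \<phi> g"
  unfolding defining_function_def by (auto intro: continuous_on_subset)

lemma defining_function_uminus:
  "defining_function \<Gamma> U \<phi> g \<Longrightarrow> defining_function \<Gamma> U (\<lambda>y. - \<phi> y) (\<lambda>y. - g y)"
  unfolding defining_function_def
  by (auto intro!: continuous_intros derivative_eq_intros simp: inner_minus_left)

text \<open>Three continuous derivatives of the defining function give a gradient with a continuous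
  derivative \<open>G\<close>, which is the regularity that makes the Weingarten map continuous.\<close>

lemma Ck_hypersurface_defining_function:
  fixes \<Gamma> :: "(real^'n) set"
  assumes "Ck_hypersurface 3 \<Gamma>" and "x \<in> \<Gamma>"
  obtains U \<phi> g G where "x \<in> U" "defining_function \<Gamma> U \<phi> g"
    "\<And>y. y \<in> U \<Longrightarrow> (g has_derivative G y) (at y)" "\<And>h. continuous_on U (\<lambda>y. G y h)"
proof -
  obtain U and \<phi> :: "real^'n \<Rightarrow> real" where U: "open U" "x \<in> U" "Ck_on 3 U \<phi>"
      "\<Gamma> \<inter> U = {y\<in>U. \<phi> y = 0}" "\<And>y. y \<in> U \<Longrightarrow> frechet_derivative \<phi> (at y) \<noteq> (\<lambda>_. 0)"
    using assms unfolding Ck_hypersurface_def by meson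
  define p where "p = (\<lambda>b y. frechet_derivative \<phi> (at y) b)"
  define g where "g = (\<lambda>y. \<Sum>b\<in>Basis. p b y *\<^sub>R b)"
  define G where "G = (\<lambda>y h. \<Sum>b\<in>Basis. frechet_derivative (p b) (at y) h *\<^sub>R b)"
  have Ck: "\<phi> differentiable (at y)" "b \<in> Basis \<Longrightarrow> p b differentiable (at y)"
    "b \<in> Basis \<Longrightarrow> c \<in> Basis \<Longrightarrow> (\<lambda>y. frechet_derivative (p b) (at y) c) differentiable (at y)"
    if "y \<in> U" for y b c
    using U(3) that by (auto simp: numeral_3_eq_3 p_def)
  have g: "g y \<bullet> h = frechet_derivative \<phi> (at y) h" if "y \<in> U" for y h
    unfolding g_def p_def
    by (rule inner_sum_Basis_of_linear) (rule linear_frechet_derivative[OF Ck(1)[OF that]])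
  have dg: "(g has_derivative G y) (at y)" if "y \<in> U" for y
    unfolding g_def G_def using Ck(2)[OF that]
    by (intro has_derivative_sum has_derivative_scaleR_left) (simp flip: frechet_derivative_works)
  have df: "defining_function \<Gamma> U \<phi> g"
    unfolding defining_function_def
  proof (intro conjI ballI)
    fix y assume y: "y \<in> U"
    have eq: "(\<lambda>h. g y \<bullet> h) = frechet_derivative \<phi> (at y)" using g[OF y] by auto
    then show "(\<phi> has_derivative (\<lambda>h. g y \<bullet> h)) (at y)"
      using Ck(1)[OF y] by (simp flip: frechet_derivative_works)
    show "g y \<noteq> 0" using U(5)[OF y] eq by auto
  next
    show "continuous_on U g"
      using dg by (auto intro!: continuous_at_imp_continuous_on has_derivative_continuous)
  qed (use U in auto)
  have "continuous_on U (\<lambda>y. G y h)" for h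
  proof -
    have c: "continuous_on U (\<lambda>y. G y c)" if "c \<in> Basis" for c
      unfolding G_def using Ck(3) that
      by (intro continuous_intros continuous_at_imp_continuous_on ballI
          differentiable_imp_continuous_within) auto
    have "G y h = (\<Sum>c\<in>Basis. (h \<bullet> c) *\<^sub>R G y c)" if "y \<in> U" for y
    proof -
      have l: "linear (G y)" using dg[OF that] by (rule has_derivative_linear)
      have "G y h = G y (\<Sum>c\<in>Basis. (h \<bullet> c) *\<^sub>R c)" by (simp add: euclidean_representation)
      then show ?thesis by (simp add: linear_sum[OF l] linear_scale[OF l])
    qed
    moreover have "continuous_on U (\<lambda>y. \<Sum>c\<in>Basis. (h \<bullet> c) *\<^sub>R G y c)"
      by (intro continuous_intros c)
    ultimately show ?thesis by (simp cong: continuous_on_cong_simp)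
  qed
  with U(2) df dg show thesis by (rule that)
qed

lemma defining_function_directional:
  assumes "defining_function \<Gamma> U \<phi> g" "x \<in> U"
  shows "((\<lambda>t. \<phi> (x + t *\<^sub>R v)) has_real_derivative (g x \<bullet> v)) (at 0)"
proof -
  have "(\<phi> has_derivative (\<lambda>h. g x \<bullet> h)) (at (x + 0 *\<^sub>R v))"
    using assms by (simp add: defining_function_def)
  then have "((\<lambda>t. \<phi> (x + t *\<^sub>R v)) has_derivative (\<lambda>t. g x \<bullet> (t *\<^sub>R v))) (at 0)"
    by (rule has_derivative_compose[rotated]) (auto intro!: derivative_eq_intros)
  then show ?thesis
    by (rule has_derivative_imp_has_field_derivative) simp
qed

text \<open>For small \<open>t > 0\<close> the defining function is positive at \<open>x + t (v + \<epsilon> g x)\<close> and negative at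
  \<open>x + t (v - \<epsilon> g x)\<close>, because its derivatives in these directions are \<open>\<plusminus> \<epsilon> |g x|\<^sup>2\<close>. The
  intermediate value theorem yields a point of \<open>\<Gamma>\<close> in between. This replaces the implicit function
  theorem in the construction of curves with a prescribed velocity.\<close>

lemma defining_function_zero_near:
  fixes \<Gamma> :: "'a::euclidean_space set"
  assumes D: "defining_function \<Gamma> U \<phi> g" and x: "x \<in> \<Gamma> \<inter> U" and v: "g x \<bullet> v = 0" and "\<epsilon> > 0"
  shows "\<forall>\<^sub>F t in at_right 0. \<exists>s. \<bar>s\<bar> \<le> \<epsilon> * t \<and> x + t *\<^sub>R v + s *\<^sub>R g x \<in> \<Gamma>"
proof -
  let ?e = "g x"
  have U: "open U" "\<Gamma> \<inter> U = {y\<in>U. \<phi> y = 0}" and xU: "x \<in> U" "\<phi> x = 0"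
    and e: "?e \<bullet> ?e > 0"
    using D x by (auto simp: defining_function_def)
  have cont: "continuous_on U \<phi>"
    using D by (auto simp: defining_function_def
        intro!: continuous_at_imp_continuous_on has_derivative_continuous)
  obtain r where r: "r > 0" "ball x r \<subseteq> U"
    using U(1) xU(1) open_contains_ball by blast
  have 1: "\<forall>\<^sub>F t in at_right 0. 0 < \<phi> (x + t *\<^sub>R (v + \<epsilon> *\<^sub>R ?e))"
    using has_real_derivative_pos_inc_right[OF defining_function_directional[OF D xU(1), of "v + \<epsilon> *\<^sub>R ?e"]]
      e \<open>\<epsilon> > 0\<close> v xU(2)
    by (auto simp: eventually_at_right_field inner_add_right)
  have 2: "\<forall>\<^sub>F t in at_right 0. \<phi> (x + t *\<^sub>R (v - \<epsilon> *\<^sub>R ?e)) < 0"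
    using has_real_derivative_neg_dec_right[OF defining_function_directional[OF D xU(1), of "v - \<epsilon> *\<^sub>R ?e"]]
      e \<open>\<epsilon> > 0\<close> v xU(2)
    by (auto simp: eventually_at_right_field inner_diff_right)
  have 3: "\<forall>\<^sub>F t in at_right 0. t * (norm v + \<epsilon> * norm ?e) < r"
    using r(1) by (intro order_tendstoD(2)[where y = "0 * (norm v + \<epsilon> * norm ?e)"] tendsto_intros) auto
  have 4: "\<forall>\<^sub>F t in at_right 0. (0::real) < t"
    by (rule eventually_at_right_less)
  from 1 2 3 4 show ?thesis
  proof eventually_elim
    case (elim t)
    let ?f = "\<lambda>s. \<phi> (x + t *\<^sub>R v + s *\<^sub>R ?e)"
    have in_U: "x + t *\<^sub>R v + s *\<^sub>R ?e \<in> U" if "\<bar>s\<bar> \<le> \<epsilon> * t" for s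
    proof -
      have "norm (t *\<^sub>R v + s *\<^sub>R ?e) \<le> norm (t *\<^sub>R v) + norm (s *\<^sub>R ?e)" by (rule norm_triangle_ineq)
      also have "\<dots> \<le> t * norm v + \<epsilon> * t * norm ?e"
        using that elim(4) by (auto intro: mult_right_mono)
      also have "\<dots> < r" using elim(3) by (simp add: algebra_simps)
      finally have "dist x (x + t *\<^sub>R v + s *\<^sub>R ?e) < r"
        using norm_minus_cancel[of "t *\<^sub>R v + s *\<^sub>R ?e"] by (simp add: dist_norm)
      then show ?thesis using r(2) by auto
    qed
    have "continuous_on {- (\<epsilon> * t)..\<epsilon> * t} ?f"
      by (rule continuous_on_compose2[OF cont]) (use in_U in \<open>auto intro!: continuous_intros\<close>)
    moreover have "?f (- (\<epsilon> * t)) \<le> 0" "0 \<le> ?f (\<epsilon> * t)"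
      using elim(1,2) by (auto simp: algebra_simps)
    ultimately obtain s where "- (\<epsilon> * t) \<le> s" "s \<le> \<epsilon> * t" "?f s = 0"
      using IVT'[of ?f "- (\<epsilon> * t)" 0 "\<epsilon> * t"] \<open>\<epsilon> > 0\<close> elim(4) by auto
    moreover from this have s: "\<bar>s\<bar> \<le> \<epsilon> * t" by simp
    ultimately have "x + t *\<^sub>R v + s *\<^sub>R ?e \<in> \<Gamma>" using in_U[OF s] U(2) by blast
    with s show ?case by blast
  qed
qed

text \<open>Differentiating \<open>\<phi> \<circ> \<gamma> = 0\<close> shows that velocities are orthogonal to the gradient.
  Conversely, for \<open>v\<close> orthogonal to the gradient, the curve \<open>x + t v\<close> is corrected in the
  direction of the gradient so that it stays in \<open>\<Gamma>\<close>. The correction is chosen of least modulus,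
  which is possible because \<open>\<Gamma>\<close> is closed; since corrections of size at most \<open>\<epsilon> |t|\<close> exist for
  every \<open>\<epsilon>\<close>, the least one is \<open>o(t)\<close>.\<close>

lemma tangent_space_defining_function:
  fixes \<Gamma> :: "(real^'n) set"
  assumes "closed \<Gamma>" and D: "defining_function \<Gamma> U \<phi> g" and x: "x \<in> \<Gamma> \<inter> U"
  shows "tangent_space \<Gamma> x = {v. g x \<bullet> v = 0}"
proof (intro set_eqI iffI)
  fix v assume "v \<in> tangent_space \<Gamma> x"
  then obtain \<gamma> where \<gamma>: "\<gamma> 0 = x" "\<And>t::real. \<gamma> t \<in> \<Gamma>" "(\<gamma> has_vector_derivative v) (at 0)"
    by (auto simp: tangent_space_def)
  have "(\<phi> has_derivative (\<lambda>h. g x \<bullet> h)) (at (\<gamma> 0))"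
    using D x \<gamma>(1) by (simp add: defining_function_def)
  then have "((\<lambda>t. \<phi> (\<gamma> t)) has_derivative (\<lambda>t. g x \<bullet> (t *\<^sub>R v))) (at 0)"
    using \<gamma>(3) unfolding has_vector_derivative_def by (rule has_derivative_compose[rotated])
  then have 1: "((\<lambda>t. \<phi> (\<gamma> t)) has_real_derivative (g x \<bullet> v)) (at 0)"
    by (rule has_derivative_imp_has_field_derivative) simp
  have "open U" using D by (simp add: defining_function_def)
  moreover have "isCont \<gamma> 0" using \<gamma>(3) by (rule has_vector_derivative_continuous)
  ultimately have "\<forall>\<^sub>F t in nhds 0. \<gamma> t \<in> U"
    using x \<gamma>(1) unfolding isCont_def tendsto_at_iff_tendsto_nhds by (metis IntD2 topological_tendstoD)
  then have "\<forall>\<^sub>F t in nhds 0. \<phi> (\<gamma> t) = 0"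
    by eventually_elim (use D \<gamma>(2) in \<open>auto simp: defining_function_def\<close>)
  then have "((\<lambda>t. \<phi> (\<gamma> t)) has_real_derivative 0) (at 0)"
    by (subst DERIV_cong_ev[OF refl _ refl, where g = "\<lambda>_. 0"]) auto
  with 1 show "v \<in> {v. g x \<bullet> v = 0}"
    using DERIV_unique by blast
next
  fix v assume "v \<in> {v. g x \<bullet> v = 0}"
  then have v: "g x \<bullet> v = 0" by simp
  let ?m = "\<lambda>t::real. {s. x + t *\<^sub>R v + s *\<^sub>R g x \<in> \<Gamma>}"
  have "closed (?m t)" for t
    using continuous_closed_vimage[OF \<open>closed \<Gamma>\<close>, of "\<lambda>s. x + t *\<^sub>R v + s *\<^sub>R g x"]
    by (auto simp: vimage_def intro!: continuous_intros)
  then have "\<exists>s\<in>?m t. \<forall>s'\<in>?m t. \<bar>s\<bar> \<le> \<bar>s'\<bar>" if "?m t \<noteq> {}" for t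
    by (rule distance_attains_inf[OF _ that, of 0]) (auto simp: dist_real_def)
  then have "\<exists>s. ?m t \<noteq> {} \<longrightarrow> s \<in> ?m t \<and> (\<forall>s'\<in>?m t. \<bar>s\<bar> \<le> \<bar>s'\<bar>)" for t
    by blast
  then obtain s where s: "\<And>t. ?m t \<noteq> {} \<Longrightarrow> s t \<in> ?m t"
      "\<And>t s'. s' \<in> ?m t \<Longrightarrow> \<bar>s t\<bar> \<le> \<bar>s'\<bar>"
    by (metis empty_iff)
  \<comment> \<open>The curve has to stay in \<open>\<Gamma>\<close> for all times, so it rests at \<open>x\<close> where no correction exists.\<close>
  define \<gamma> where "\<gamma> = (\<lambda>t. if ?m t = {} then x else x + t *\<^sub>R v + s t *\<^sub>R g x)"
  have "s 0 = 0" using s(2)[of 0 0] x by auto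
  then have \<gamma>0: "\<gamma> 0 = x" by (simp add: \<gamma>_def)
  have \<gamma>\<Gamma>: "\<gamma> t \<in> \<Gamma>" for t using s(1)[of t] x by (auto simp: \<gamma>_def)
  have "(\<gamma> has_derivative (\<lambda>t. t *\<^sub>R v)) (at 0)"
    unfolding has_derivative_at_alt
  proof (intro conjI allI impI)
    fix \<epsilon> :: real assume "\<epsilon> > 0"
    define \<epsilon>' where "\<epsilon>' = \<epsilon> / norm (g x)"
    have gx: "g x \<noteq> 0" using D x by (simp add: defining_function_def)
    have \<epsilon>': "\<epsilon>' > 0" using gx \<open>\<epsilon> > 0\<close> by (simp add: \<epsilon>'_def)
    obtain d1 where d1: "d1 > 0" "\<And>t. 0 < t \<Longrightarrow> t < d1 \<Longrightarrow> \<exists>s. \<bar>s\<bar> \<le> \<epsilon>' * t \<and> x + t *\<^sub>R v + s *\<^sub>R g x \<in> \<Gamma>"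
      using defining_function_zero_near[OF D x v \<epsilon>'] by (auto simp: eventually_at_right_field)
    obtain d2 where d2: "d2 > 0" "\<And>t. 0 < t \<Longrightarrow> t < d2 \<Longrightarrow> \<exists>s. \<bar>s\<bar> \<le> \<epsilon>' * t \<and> x + t *\<^sub>R (- v) + s *\<^sub>R g x \<in> \<Gamma>"
      using defining_function_zero_near[OF D x _ \<epsilon>', of "- v"] v by (auto simp: eventually_at_right_field)
    have near: "\<exists>s. \<bar>s\<bar> \<le> \<epsilon>' * \<bar>t\<bar> \<and> s \<in> ?m t" if "\<bar>t\<bar> < min d1 d2" for t
      using d1(2)[of t] d2(2)[of "- t"] that x by (cases "t = 0"; cases "t > 0") auto
    have "norm (\<gamma> t - \<gamma> 0 - (t - 0) *\<^sub>R v) \<le> \<epsilon> * norm (t - 0)" if t: "norm (t - 0) < min d1 d2" for t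
    proof -
      obtain s' where s': "\<bar>s'\<bar> \<le> \<epsilon>' * \<bar>t\<bar>" "s' \<in> ?m t" using near[of t] t by auto
      then have "\<gamma> t - \<gamma> 0 - (t - 0) *\<^sub>R v = s t *\<^sub>R g x" by (auto simp: \<gamma>0) (auto simp: \<gamma>_def)
      moreover have "\<bar>s t\<bar> * norm (g x) \<le> \<epsilon>' * \<bar>t\<bar> * norm (g x)"
        using s(2)[OF s'(2)] s'(1) by (intro mult_right_mono) auto
      ultimately show ?thesis using gx by (simp add: \<epsilon>'_def)
    qed
    then show "\<exists>d>0. \<forall>t. norm (t - 0) < d \<longrightarrow> norm (\<gamma> t - \<gamma> 0 - (t - 0) *\<^sub>R v) \<le> \<epsilon> * norm (t - 0)"
      using d1(1) d2(1) by (intro exI[of _ "min d1 d2"]) auto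
  qed (rule bounded_linear_scaleR_left)
  then show "v \<in> tangent_space \<Gamma> x"
    using \<gamma>0 \<gamma>\<Gamma> unfolding tangent_space_def has_vector_derivative_def by blast
qed

section \<open>The tangential gradient\<close>

text \<open>Along a curve in \<open>\<Gamma>\<close> with velocity \<open>v\<close> the function has the derivative \<open>u \<bullet> v\<close> and also
  \<open>w \<bullet> v\<close>. Taking for \<open>v\<close> the tangent vectors \<open>u\<close> and \<open>w\<close> themselves gives \<open>|u - w|\<^sup>2 = 0\<close>.\<close>

lemma tangential_derivative_unique:
  assumes "u \<in> tangent_space \<Gamma> x" "(f has_derivative (\<lambda>h. u \<bullet> h)) (at x within \<Gamma>)"
    and "w \<in> tangent_space \<Gamma> x" "(f has_derivative (\<lambda>h. w \<bullet> h)) (at x within \<Gamma>)"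
  shows "u = w"
proof -
  have agree: "u \<bullet> v = w \<bullet> v" if v: "v \<in> tangent_space \<Gamma> x" for v
  proof -
    obtain \<gamma> where \<gamma>: "\<gamma> 0 = x" "\<And>t::real. \<gamma> t \<in> \<Gamma>" "(\<gamma> has_derivative (\<lambda>t. t *\<^sub>R v)) (at 0)"
      using v unfolding tangent_space_def has_vector_derivative_def by blast
    have "((\<lambda>t. f (\<gamma> t)) has_derivative (\<lambda>t. z \<bullet> (t *\<^sub>R v))) (at 0)"
      if "(f has_derivative (\<lambda>h. z \<bullet> h)) (at x within \<Gamma>)" for z
      by (rule has_derivative_in_compose[OF \<gamma>(3)])
         (use \<gamma>(1,2) that in \<open>auto intro: has_derivative_subset\<close>)
    from has_derivative_unique[OF this[OF assms(2)] this[OF assms(4)]]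
    show ?thesis by (auto dest: fun_cong[of _ _ 1])
  qed
  have "(u - w) \<bullet> (u - w) = 0"
    using agree[OF assms(1)] agree[OF assms(3)] by (simp add: inner_diff_left inner_diff_right inner_commute)
  then show ?thesis by simp
qed

text \<open>A function on \<open>\<Gamma>\<close> does not change when a multiple of \<open>\<phi>\<close> is subtracted from its extension.
  The multiple is chosen such that it removes the component of the gradient along \<open>g x\<close>.\<close>

lemma tangential_gradient_eq:
  fixes \<Gamma> :: "(real^'n) set"
  assumes "closed \<Gamma>" and D: "defining_function \<Gamma> U \<phi> g" and x: "x \<in> \<Gamma> \<inter> U"
    and F: "(F has_derivative (\<lambda>h. d \<bullet> h)) (at x)" and eq: "\<And>y. y \<in> \<Gamma> \<inter> U \<Longrightarrow> f y = F y"
  shows "tangential_gradient \<Gamma> f x = d - (d \<bullet> sgn (g x)) *\<^sub>R sgn (g x)"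
proof -
  define c where "c = (d \<bullet> g x) / (g x \<bullet> g x)"
  define w where "w = d - c *\<^sub>R g x"
  have gx: "g x \<noteq> 0" and d\<phi>: "(\<phi> has_derivative (\<lambda>h. g x \<bullet> h)) (at x)" and "open U"
    and zero: "\<And>y. y \<in> \<Gamma> \<inter> U \<Longrightarrow> \<phi> y = 0"
    using D x by (auto simp: defining_function_def)
  have wT: "w \<in> tangent_space \<Gamma> x"
    using gx by (simp add: tangent_space_defining_function[OF assms(1) D x] w_def c_def
        inner_diff_right inner_commute)
  obtain r where r: "r > 0" "ball x r \<subseteq> U"
    using \<open>open U\<close> x open_contains_ball by blast
  have "((\<lambda>y. F y - c * \<phi> y) has_derivative (\<lambda>h. w \<bullet> h)) (at x within \<Gamma>)"
    unfolding w_def by (rule has_derivative_at_withinI)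
      (auto intro!: derivative_eq_intros F d\<phi> simp: inner_diff_left)
  then have wd: "(f has_derivative (\<lambda>h. w \<bullet> h)) (at x within \<Gamma>)"
    by (rule has_derivative_transform_within[OF _ r(1)])
       (use x r eq zero in \<open>auto simp: dist_commute subset_iff\<close>)
  have "tangential_gradient \<Gamma> f x = w"
    unfolding tangential_gradient_def
    using wT wd tangential_derivative_unique by (intro the_equality) blast+
  also have "w = d - (d \<bullet> sgn (g x)) *\<^sub>R sgn (g x)"
    using gx by (simp add: w_def c_def sgn_div_norm power2_eq_square divide_simps flip: power2_norm_eq_inner)
  finally show ?thesis .
qed

section \<open>Regularity of the outward normal\<close>

text \<open>The component of a normal vector orthogonal to the gradient is itself tangential, hence
  orthogonal to the normal vector, hence zero.\<close>

lemma unit_normal_eq_sgn_gradient: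
  fixes \<Gamma> :: "(real^'n) set"
  assumes "closed \<Gamma>" and D: "defining_function \<Gamma> U \<phi> g" and x: "x \<in> \<Gamma> \<inter> U"
    and n: "norm m = 1" "\<And>v. v \<in> tangent_space \<Gamma> x \<Longrightarrow> m \<bullet> v = 0"
  shows "m \<bullet> g x \<noteq> 0" "m \<bullet> g x > 0 \<Longrightarrow> m = sgn (g x)"
proof -
  define c where "c = (m \<bullet> g x) / (g x \<bullet> g x)"
  have gx: "g x \<noteq> 0" using D x by (auto simp: defining_function_def)
  have perp: "g x \<bullet> (m - c *\<^sub>R g x) = 0"
    using gx by (simp add: c_def inner_diff_right inner_commute)
  then have "m - c *\<^sub>R g x \<in> tangent_space \<Gamma> x"
    by (simp add: tangent_space_defining_function[OF assms(1) D x])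
  then have "m \<bullet> (m - c *\<^sub>R g x) = 0" by (rule n(2))
  with perp have "(m - c *\<^sub>R g x) \<bullet> (m - c *\<^sub>R g x) = 0" by (simp add: inner_diff_left)
  then have m: "m = c *\<^sub>R g x" by simp
  with n(1) show "m \<bullet> g x \<noteq> 0" using gx by auto
  assume "m \<bullet> g x > 0"
  then have "c > 0" using gx by (simp add: c_def)
  then have "sgn m = sgn (g x)" by (subst m) (simp add: sgn_scaleR)
  then show "m = sgn (g x)" using n(1) by (simp add: sgn_div_norm)
qed

lemma inside_outside_not_connected:
  assumes "connected S" "S \<subseteq> - \<Gamma>" "p \<in> S" "q \<in> S" "p \<in> outside \<Gamma>" "q \<in> inside \<Gamma>"
  shows False
proof -
  have "connected_component (- \<Gamma>) p q"
    using assms by (auto simp: connected_component_def)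
  then have "q \<in> outside \<Gamma>" using assms(5) by (rule outside_same_component)
  then show False using assms(6) inside_Int_outside by blast
qed

text \<open>The normal is \<open>\<plusminus> g / |g|\<close>, and the point is that the sign cannot jump. Put \<open>e = n x\<close>. Near
  \<open>x\<close> the function \<open>\<phi>\<close> increases in the direction \<open>e\<close>, and \<open>q = x - s e\<close> is a point inside \<open>\<Gamma>\<close>
  with \<open>\<phi> q < 0\<close>. If the sign were wrong at a nearby \<open>y \<in> \<Gamma>\<close>, then a point \<open>p = y + t n y\<close>
  outside \<open>\<Gamma>\<close> would satisfy \<open>\<phi> p < 0\<close> too. Moving from \<open>p\<close> to \<open>p - s e\<close> does not increase \<open>\<phi>\<close>, and
  \<open>p - s e\<close> lies in a ball around \<open>q\<close> on which \<open>\<phi> < 0\<close>. So \<open>p\<close> and \<open>q\<close> are joined by a path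
  in \<open>{\<phi> < 0}\<close>, which avoids \<open>\<Gamma>\<close>, although one is outside and the other inside.\<close>

lemma outward_normal_sign_constant:
  fixes \<Gamma> :: "(real^'n) set"
  assumes "closed \<Gamma>" and N: "outward_unit_normal \<Gamma> n"
    and D: "defining_function \<Gamma> U \<phi> g" and x: "x \<in> \<Gamma> \<inter> U" and pos: "n x \<bullet> g x > 0"
  shows "\<exists>V. open V \<and> x \<in> V \<and> V \<subseteq> U \<and> (\<forall>y\<in>\<Gamma> \<inter> V. n y = sgn (g y))"
proof -
  define e where "e = n x"
  have U: "open U" "\<And>y. y \<in> U \<Longrightarrow> (\<phi> has_derivative (\<lambda>h. g y \<bullet> h)) (at y)"
      "continuous_on U g" "\<And>y. y \<in> U \<Longrightarrow> y \<in> \<Gamma> \<longleftrightarrow> \<phi> y = 0"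
    using D by (auto simp: defining_function_def)
  have nD: "norm (n y) = 1" "\<And>v. v \<in> tangent_space \<Gamma> y \<Longrightarrow> n y \<bullet> v = 0"
    "\<forall>\<^sub>F t in at_right 0. y + t *\<^sub>R n y \<in> outside \<Gamma>"
    "\<forall>\<^sub>F t in at_right 0. y - t *\<^sub>R n y \<in> inside \<Gamma>" if "y \<in> \<Gamma>" for y
    using N that by (auto simp: outward_unit_normal_def eventually_conj_iff)
  have "isCont (\<lambda>y. e \<bullet> g y) x"
    using U(1,3) x by (intro continuous_intros) (simp add: continuous_on_eq_continuous_at)
  then have "\<forall>\<^sub>F y in nhds x. e \<bullet> g y > 0"
    using pos tendsto_at_iff_tendsto_nhds[of "\<lambda>y. e \<bullet> g y" x]
    unfolding e_def isCont_def by (metis order_tendstoD(1))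
  moreover have "\<forall>\<^sub>F y in nhds x. y \<in> U"
    using U(1) x by (intro eventually_nhds_in_open) auto
  ultimately have "\<forall>\<^sub>F y in nhds x. e \<bullet> g y > 0 \<and> y \<in> U"
    by eventually_elim auto
  then obtain r where r: "r > 0" "\<And>y. dist y x < r \<Longrightarrow> e \<bullet> g y > 0 \<and> y \<in> U"
    by (auto simp: eventually_nhds_metric)
  have dir: "((\<lambda>t. \<phi> (p - t *\<^sub>R e)) has_real_derivative (- (e \<bullet> g (p - t *\<^sub>R e)))) (at t)"
    if "p - t *\<^sub>R e \<in> U" for p t
  proof -
    have "((\<lambda>t. \<phi> (p - t *\<^sub>R e)) has_derivative (\<lambda>h. g (p - t *\<^sub>R e) \<bullet> (- (h *\<^sub>R e)))) (at t)"
      by (rule has_derivative_compose[where f = "\<lambda>t. p - t *\<^sub>R e", OF _ U(2)[OF that]])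
         (auto intro!: derivative_eq_intros)
    then show ?thesis
      by (rule has_derivative_imp_has_field_derivative) (simp add: inner_commute)
  qed
  have decr: "\<phi> (p - s *\<^sub>R e) \<le> \<phi> p" if "0 \<le> s" "dist p x + s < r" for p s
  proof -
    have in_ball: "dist (p - t *\<^sub>R e) x < r" if "0 \<le> t" "t \<le> s" for t
    proof -
      have "dist (p - t *\<^sub>R e) x \<le> dist (p - t *\<^sub>R e) p + dist p x" by (rule dist_triangle)
      also have "dist (p - t *\<^sub>R e) p = t"
        using that nD(1)[of x] x by (simp add: dist_norm e_def)
      finally show ?thesis using that \<open>dist p x + s < r\<close> by simp
    qed
    have "\<phi> (p - s *\<^sub>R e) \<le> \<phi> (p - 0 *\<^sub>R e)"
    proof (rule DERIV_nonpos_imp_nonincreasing[OF \<open>0 \<le> s\<close>, of "\<lambda>t. \<phi> (p - t *\<^sub>R e)"])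
      fix t assume "0 \<le> t" "t \<le> s"
      then have *: "e \<bullet> g (p - t *\<^sub>R e) > 0 \<and> p - t *\<^sub>R e \<in> U" by (intro r(2) in_ball)
      then show "\<exists>y. ((\<lambda>t. \<phi> (p - t *\<^sub>R e)) has_real_derivative y) (at t) \<and> y \<le> 0"
        using dir[of p t] by (intro exI[of _ "- (e \<bullet> g (p - t *\<^sub>R e))"]) simp
    qed
    then show ?thesis by simp
  qed
  have "\<forall>\<^sub>F s in at_right 0. \<phi> (x - s *\<^sub>R e) < 0"
    using has_real_derivative_neg_dec_right[OF defining_function_directional[OF D, of x "- e"]]
      pos x U(4)[of x] by (auto simp: eventually_at_right_field e_def inner_commute)
  moreover have "\<forall>\<^sub>F s in at_right 0. x - s *\<^sub>R e \<in> inside \<Gamma>"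
    unfolding e_def using nD(4) x by blast
  moreover have "\<forall>\<^sub>F s in at_right (0::real). 0 < s \<and> s < r / 2"
    using r(1) by (auto simp: eventually_at_right_field intro!: exI[of _ "r / 2"])
  ultimately have "\<forall>\<^sub>F s in at_right 0. \<phi> (x - s *\<^sub>R e) < 0 \<and> x - s *\<^sub>R e \<in> inside \<Gamma> \<and> 0 < s \<and> s < r / 2"
    by eventually_elim auto
  then obtain s where s: "\<phi> (x - s *\<^sub>R e) < 0" "x - s *\<^sub>R e \<in> inside \<Gamma>" "0 < s" "s < r / 2"
    using eventually_happens'[OF trivial_limit_at_right_real] by blast
  define q where "q = x - s *\<^sub>R e"
  have q: "dist q x = s" "\<phi> q < 0" "q \<in> inside \<Gamma>"
    using s nD(1)[of x] x by (auto simp: q_def dist_norm e_def)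
  have "isCont \<phi> q"
    using U(2) r(2)[of q] q(1) s by (auto intro: has_derivative_continuous)
  then have "\<forall>\<^sub>F y in nhds q. \<phi> y < 0"
    using q(2) unfolding isCont_def tendsto_at_iff_tendsto_nhds by (rule order_tendstoD(2))
  then obtain \<delta>' where \<delta>': "\<delta>' > 0" "\<And>y. dist y q < \<delta>' \<Longrightarrow> \<phi> y < 0"
    by (auto simp: eventually_nhds_metric)
  define \<delta> where "\<delta> = min \<delta>' (r / 2)"
  have \<delta>: "\<delta> > 0" "\<delta> \<le> r / 2" "\<delta> \<le> \<delta>'" using \<delta>' r by (auto simp: \<delta>_def)
  have nsgn: "n y = sgn (g y)" if y: "y \<in> \<Gamma>" "dist y x < \<delta>" for y
  proof (rule ccontr)
    assume neq: "n y \<noteq> sgn (g y)"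
    have yU: "y \<in> \<Gamma> \<inter> U" using r(2)[of y] y \<delta> r(1) by auto
    have neg: "g y \<bullet> n y < 0"
      using unit_normal_eq_sgn_gradient[OF assms(1) D yU nD(1,2)[OF y(1)]] neq
      by (force simp: inner_commute)
    have "\<forall>\<^sub>F t in at_right 0. \<phi> (y + t *\<^sub>R n y) < 0"
      using has_real_derivative_neg_dec_right[OF defining_function_directional[OF D, of y "n y"] neg]
        yU U(4)[of y] by (auto simp: eventually_at_right_field)
    moreover have "\<forall>\<^sub>F t in at_right (0::real). 0 < t \<and> t < \<delta> - dist y x"
      using y(2) by (auto simp: eventually_at_right_field intro!: exI[of _ "\<delta> - dist y x"])
    ultimately have "\<forall>\<^sub>F t in at_right 0. \<phi> (y + t *\<^sub>R n y) < 0 \<and> y + t *\<^sub>R n y \<in> outside \<Gamma>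
        \<and> 0 < t \<and> t < \<delta> - dist y x"
      using nD(3)[OF y(1)] by eventually_elim auto
    then obtain t where t: "\<phi> (y + t *\<^sub>R n y) < 0" "y + t *\<^sub>R n y \<in> outside \<Gamma>" "0 < t" "t < \<delta> - dist y x"
      using eventually_happens'[OF trivial_limit_at_right_real] by blast
    define p where "p = y + t *\<^sub>R n y"
    have px: "dist p x < \<delta>"
    proof -
      have "dist p x \<le> dist p y + dist y x" by (rule dist_triangle)
      also have "dist p y = t" using t(3) nD(1)[OF y(1)] by (simp add: p_def dist_norm)
      finally show ?thesis using t(4) by simp
    qed
    let ?S = "closed_segment p (p - s *\<^sub>R e) \<union> closed_segment (p - s *\<^sub>R e) q"
    have near_q: "dist (p - s *\<^sub>R e) q < \<delta>" using px by (simp add: q_def dist_norm)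
    have neg1: "\<phi> z < 0 \<and> z \<in> U" if z: "z \<in> closed_segment p (p - s *\<^sub>R e)" for z
    proof -
      obtain u where u: "0 \<le> u" "u \<le> 1" "z = p - (u * s) *\<^sub>R e"
        using z by (auto simp: closed_segment_def algebra_simps)
      have us: "0 \<le> u * s" "u * s \<le> s" using u s(3) by (auto simp: mult_left_le_one_le)
      have "\<phi> z \<le> \<phi> p" unfolding u(3) using us px \<delta> s(4) by (intro decr) auto
      moreover have "dist z x < r"
      proof -
        have "dist z x \<le> dist z p + dist p x" by (rule dist_triangle)
        also have "dist z p = u * s" using us(1) nD(1)[of x] x s(3) u(1) by (simp add: u(3) dist_norm e_def)
        finally show ?thesis using us(2) px \<delta> s(4) by simp
      qed
      ultimately show ?thesis using t(1) r(2) by (auto simp: p_def)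
    qed
    have neg2: "\<phi> z < 0 \<and> z \<in> U" if "z \<in> closed_segment (p - s *\<^sub>R e) q" for z
    proof -
      have "closed_segment (p - s *\<^sub>R e) q \<subseteq> ball q \<delta>"
        using near_q \<delta>(1) by (intro closed_segment_subset) (auto simp: dist_commute)
      then have z: "dist z q < \<delta>" using that by (auto simp: dist_commute)
      have "dist z x \<le> dist z q + dist q x" by (rule dist_triangle)
      then have "dist z x < r" using z q(1) s(4) \<delta> by simp
      then show ?thesis using z \<delta>'(2)[of z] \<delta>(3) r(2) by auto
    qed
    have "connected ?S" by (rule connected_Un) auto
    moreover have "?S \<subseteq> - \<Gamma>"
    proof
      fix z assume "z \<in> ?S"
      then have "\<phi> z < 0 \<and> z \<in> U" using neg1 neg2 by blast
      then show "z \<in> - \<Gamma>" using U(4)[of z] by auto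
    qed
    ultimately show False
      by (rule inside_outside_not_connected[where p = p and q = q])
         (use t(2) q(3) in \<open>auto simp: p_def\<close>)
  qed
  have "\<And>y. dist y x < \<delta> \<Longrightarrow> y \<in> U" using r \<delta> by force
  then show ?thesis using nsgn \<delta>(1) by (intro exI[of _ "ball x \<delta>"]) (auto simp: dist_commute)
qed

text \<open>Passing from \<open>\<phi>\<close> to \<open>-\<phi>\<close> if necessary, the outward normal agrees on \<open>\<Gamma>\<close> with the
  normalised gradient, which extends it differentiably to a neighbourhood.\<close>

lemma outward_normal_local:
  fixes \<Gamma> :: "(real^'n) set"
  assumes "closed \<Gamma>" and "Ck_hypersurface 3 \<Gamma>" and N: "outward_unit_normal \<Gamma> n" and x: "x \<in> \<Gamma>"
  obtains U \<phi> g G where "x \<in> U" "defining_function \<Gamma> U \<phi> g"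
    "\<And>y. y \<in> U \<Longrightarrow> (g has_derivative G y) (at y)" "\<And>h. continuous_on U (\<lambda>y. G y h)"
    "\<And>y. y \<in> \<Gamma> \<inter> U \<Longrightarrow> n y = sgn (g y)"
proof -
  obtain U \<phi> g G where 1: "x \<in> U" "defining_function \<Gamma> U \<phi> g"
    "\<And>y. y \<in> U \<Longrightarrow> (g has_derivative G y) (at y)" "\<And>h. continuous_on U (\<lambda>y. G y h)"
    using Ck_hypersurface_defining_function[OF assms(2) x] by metis
  have xU: "x \<in> \<Gamma> \<inter> U" using x 1(1) by simp
  have "n x \<bullet> g x \<noteq> 0"
    by (rule unit_normal_eq_sgn_gradient(1)[OF assms(1) 1(2) xU])
       (use N x in \<open>auto simp: outward_unit_normal_def\<close>)
  then consider "n x \<bullet> g x > 0" | "n x \<bullet> (- g x) > 0" by fastforce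
  then show thesis
  proof cases
    case pos: 1
    obtain V where V: "open V" "x \<in> V" "V \<subseteq> U" "\<And>y. y \<in> \<Gamma> \<inter> V \<Longrightarrow> n y = sgn (g y)"
      using outward_normal_sign_constant[OF assms(1) N 1(2) xU pos] by metis
    show thesis
      by (rule that[of V \<phi> g G])
         (use V 1(3) defining_function_subset[OF 1(2)] continuous_on_subset[OF 1(4)] in auto)
  next
    case neg: 2
    note D = defining_function_uminus[OF 1(2)]
    obtain V where V: "open V" "x \<in> V" "V \<subseteq> U" "\<And>y. y \<in> \<Gamma> \<inter> V \<Longrightarrow> n y = sgn (- g y)"
      using outward_normal_sign_constant[OF assms(1) N D xU neg] by metis
    show thesis
      by (rule that[of V "\<lambda>y. - \<phi> y" "\<lambda>y. - g y" "\<lambda>y h. - G y h"])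
         (use V 1(3) defining_function_subset[OF D] continuous_on_subset[OF continuous_on_minus[OF 1(4)]]
           in \<open>auto intro: has_derivative_minus\<close>)
  qed
qed

lemma continuous_on_open_local:
  fixes f :: "'a::t2_space \<Rightarrow> 'b::topological_space"
  assumes "\<And>x. x \<in> S \<Longrightarrow> \<exists>U. open U \<and> x \<in> U \<and> continuous_on (S \<inter> U) f"
  shows "continuous_on S f"
  unfolding continuous_on_eq_continuous_within
proof
  fix x assume x: "x \<in> S"
  then obtain U where U: "open U" "x \<in> U" "continuous_on (S \<inter> U) f" using assms by blast
  have "at x within S = at x within (S \<inter> U)"
    by (rule at_within_nhd[OF U(2,1)]) auto
  then show "continuous (at x within S) f"
    using U x by (simp add: continuous_on_eq_continuous_within)
qed

lemma has_derivative_sgn_compose: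
  fixes g :: "'a::real_normed_vector \<Rightarrow> 'b::real_inner"
  assumes "(g has_derivative G) (at y)" "g y \<noteq> 0"
  shows "((\<lambda>y. sgn (g y)) has_derivative
           (\<lambda>h. G h /\<^sub>R norm (g y) - ((g y \<bullet> G h) / (norm (g y)) ^ 3) *\<^sub>R g y)) (at y)"
proof -
  have "((\<lambda>y. norm (g y)) has_derivative (\<lambda>h. G h \<bullet> sgn (g y))) (at y)"
    using assms has_derivative_compose[OF assms(1) has_derivative_norm[OF assms(2)]] by simp
  then have "((\<lambda>y. inverse (norm (g y))) has_derivative
      (\<lambda>h. - (inverse (norm (g y)) * (G h \<bullet> sgn (g y)) * inverse (norm (g y))))) (at y)"
    using assms(2) by (intro Deriv.has_derivative_inverse) auto
  from has_derivative_scaleR[OF this assms(1)]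
  show ?thesis
    unfolding sgn_div_norm
    by (rule has_derivative_eq_rhs)
       (auto simp: fun_eq_iff inner_commute divide_simps power3_eq_cube)
qed

text \<open>The extension \<open>sgn \<circ> g\<close> has a continuous derivative \<open>H\<close>, so the tangential gradients of its
  components are given by a formula that is continuous in the base point.\<close>

lemma outward_normal_regular:
  fixes \<Gamma> :: "(real^'n) set"
  assumes "closed \<Gamma>" and "Ck_hypersurface 3 \<Gamma>" and N: "outward_unit_normal \<Gamma> n"
  shows "continuous_on \<Gamma> n"
    and "continuous_on \<Gamma> (\<lambda>x. tangential_gradient \<Gamma> (\<lambda>y. n y $ i) x)"
proof -
  have *: "\<exists>U. open U \<and> x \<in> U \<and> continuous_on (\<Gamma> \<inter> U) n \<and>
      continuous_on (\<Gamma> \<inter> U) (\<lambda>x. tangential_gradient \<Gamma> (\<lambda>y. n y $ i) x)" if x: "x \<in> \<Gamma>" for x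
  proof -
    obtain U \<phi> g G where U: "x \<in> U" and D: "defining_function \<Gamma> U \<phi> g"
      and G: "\<And>y. y \<in> U \<Longrightarrow> (g has_derivative G y) (at y)" "\<And>h. continuous_on U (\<lambda>y. G y h)"
      and n: "\<And>y. y \<in> \<Gamma> \<inter> U \<Longrightarrow> n y = sgn (g y)"
      using outward_normal_local[OF assms x] by metis
    have gU: "open U" "continuous_on U g" "\<And>y. y \<in> U \<Longrightarrow> g y \<noteq> 0"
      using D by (auto simp: defining_function_def)
    have sgn_cont: "continuous_on U (\<lambda>y. sgn (g y))"
      unfolding sgn_div_norm using gU by (intro continuous_intros) auto
    have n_cont: "continuous_on (\<Gamma> \<inter> U) n"
      by (subst continuous_on_cong[OF refl n]) (auto intro: continuous_on_subset[OF sgn_cont])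
    define H where "H = (\<lambda>y h. G y h /\<^sub>R norm (g y) - ((g y \<bullet> G y h) / (norm (g y)) ^ 3) *\<^sub>R g y)"
    \<comment> \<open>\<open>d y\<close> is the gradient of the \<open>i\<close>-th component of \<open>sgn \<circ> g\<close> at \<open>y\<close>.\<close>
    define d where "d = (\<lambda>y. \<Sum>b\<in>Basis. (H y b $ i) *\<^sub>R b)"
    have H: "((\<lambda>y. sgn (g y)) has_derivative H y) (at y)" if "y \<in> U" for y
      unfolding H_def by (rule has_derivative_sgn_compose[OF G(1) gU(3)]) (use that in auto)
    have H': "((\<lambda>y. sgn (g y) $ i) has_derivative (\<lambda>h. H y h $ i)) (at y)" if "y \<in> U" for y
      by (rule bounded_linear.has_derivative[OF bounded_linear_vec_nth H[OF that]])
    have "(\<lambda>h. d y \<bullet> h) = (\<lambda>h. H y h $ i)" if "y \<in> U" for y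
      unfolding d_def using inner_sum_Basis_of_linear[OF has_derivative_linear[OF H'[OF that]]] by auto
    with H' have d: "((\<lambda>y. sgn (g y) $ i) has_derivative (\<lambda>h. d y \<bullet> h)) (at y)" if "y \<in> U" for y
      using that by simp
    have "continuous_on U (\<lambda>y. H y h)" for h
      unfolding H_def using gU G(2) by (intro continuous_intros) auto
    then have d_cont: "continuous_on U d"
      unfolding d_def by (intro continuous_intros)
    have tg: "tangential_gradient \<Gamma> (\<lambda>y. n y $ i) y = d y - (d y \<bullet> sgn (g y)) *\<^sub>R sgn (g y)"
      if "y \<in> \<Gamma> \<inter> U" for y
      by (rule tangential_gradient_eq[OF assms(1) D that d]) (use that n in auto)
    have "continuous_on (\<Gamma> \<inter> U) (\<lambda>x. tangential_gradient \<Gamma> (\<lambda>y. n y $ i) x)"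
      by (subst continuous_on_cong[OF refl tg])
         (assumption, intro continuous_on_diff continuous_on_scaleR continuous_on_inner
           continuous_on_subset[OF sgn_cont] continuous_on_subset[OF d_cont] Int_lower2)
    with n_cont U gU(1) show ?thesis by blast
  qed
  show "continuous_on \<Gamma> n"
    by (rule continuous_on_open_local) (use * in blast)
  show "continuous_on \<Gamma> (\<lambda>x. tangential_gradient \<Gamma> (\<lambda>y. n y $ i) x)"
    by (rule continuous_on_open_local) (use * in blast)
qed


section \<open>Integrability of the fields in the bilinear form\<close>

lemma tangent_proj_mult_tangential:
  assumes "v \<bullet> n x = 0"
  shows "tangent_proj n x *v v = v"
proof -
  have "(\<Sum>j\<in>UNIV. n x $ i * n x $ j * v $ j) = n x $ i * (v \<bullet> n x)" for i
    by (simp add: inner_vec_def sum_distrib_left mult_ac)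
  then have "(\<chi> i j. n x $ i * n x $ j) *v v = 0"
    by (simp add: vec_eq_iff matrix_vector_mult_def assms)
  then show ?thesis
    by (simp add: tangent_proj_def matrix_vector_mult_diff_rdistrib)
qed

lemma continuous_on_tangent_proj:
  "continuous_on \<Gamma> n \<Longrightarrow> continuous_on \<Gamma> (tangent_proj n)"
  unfolding tangent_proj_def by (intro continuous_intros)

lemma continuous_on_ricci_map:
  fixes \<Gamma> :: "(real^'n) set"
  assumes "closed \<Gamma>" "Ck_hypersurface 3 \<Gamma>" "outward_unit_normal \<Gamma> n"
  shows "continuous_on \<Gamma> (ricci_map \<Gamma> n)"
proof -
  note mult = bounded_bilinear.continuous_on[OF bounded_bilinear_matrix_matrix_mult]
  have W: "continuous_on \<Gamma> (weingarten \<Gamma> n)"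
    unfolding weingarten_def
    by (intro mult continuous_on_tangent_proj outward_normal_regular[OF assms] continuous_on_vec_lambda)
  show ?thesis
    unfolding ricci_map_def trace_def
    by (intro continuous_on_diff continuous_on_scaleR continuous_on_sum continuous_on_component W mult)
qed

lemma H1_L2:
  assumes "v \<in> H1 \<Gamma> n"
  shows "v \<in> L2 \<Gamma>" "weak_gradient \<Gamma> n v \<in> L2 \<Gamma>"
proof -
  have "is_weak_gradient \<Gamma> n v (weak_gradient \<Gamma> n v)"
    using assms unfolding H1_def weak_gradient_def mem_Collect_eq by (rule someI_ex)
  then show "v \<in> L2 \<Gamma>" "weak_gradient \<Gamma> n v \<in> L2 \<Gamma>"
    by (auto simp: is_weak_gradient_def)
qed

lemma H1_tangential_L2:
  assumes "compact \<Gamma>" "continuous_on \<Gamma> n" "v \<in> H1_tangential \<Gamma> n"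
  shows "v \<in> L2 \<Gamma>" "covariant_gradient \<Gamma> n v \<in> L2 \<Gamma>"
proof -
  have H: "(\<lambda>x. v x $ i) \<in> H1 \<Gamma> n" for i
    using assms(3) by (simp add: H1_tangential_def)
  show "v \<in> L2 \<Gamma>"
    using L2_vec[of "\<lambda>i x. v x $ i" \<Gamma>, OF H1_L2(1)[OF H]] by simp
  show "covariant_gradient \<Gamma> n v \<in> L2 \<Gamma>"
    unfolding covariant_gradient_def
    by (intro L2_continuous_mult[OF assms(1) continuous_on_tangent_proj[OF assms(2)] _
          bounded_bilinear_matrix_matrix_mult] L2_vec H1_L2(2) H)
qed

section \<open>Continuity and the Garding inequality\<close>

lemma cauchy_schwarz_pair:
  fixes x y u v :: real
  shows "x * u + y * v \<le> sqrt (x\<^sup>2 + y\<^sup>2) * sqrt (u\<^sup>2 + v\<^sup>2)"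
  using norm_cauchy_schwarz[of "(x, y)" "(u, v)"] by (simp add: norm_prod_def)

text \<open>The diagonal terms are bounded by Cauchy-Schwarz with constant \<open>1\<close>. In the coupling terms,
  the Poincare inequality bounds the vector fields by their covariant gradients, at the cost of
  \<open>C\<^sub>P\<close> and \<open>C\<^sub>P \<parallel>R\<parallel>\<^sub>\<infinity>\<close>. With \<open>a, b\<close> and \<open>a', b'\<close> the norms of the two gradients of the two
  arguments, both \<open>a a' + b b'\<close> and \<open>a b' + b a'\<close> are at most the product of the norms.\<close>

lemma form_A_continuous:
  assumes "compact \<Gamma>" and n: "continuous_on \<Gamma> n" and R: "continuous_on \<Gamma> (ricci_map \<Gamma> n)"
    and P: "poincare_constant \<Gamma> n C_P" and V: "V \<in> V11 \<Gamma> n" and W: "W \<in> V11 \<Gamma> n"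
  shows "\<bar>form_A \<Gamma> n W V\<bar> \<le> C_A \<Gamma> n C_P * norm11 \<Gamma> n W * norm11 \<Gamma> n V"
proof -
  obtain vv v ww w where VW: "V = (vv, v)" "W = (ww, w)" by (cases V, cases W)
  have H: "vv \<in> H1_tangential \<Gamma> n" "ww \<in> H1_tangential \<Gamma> n" "v \<in> H1 \<Gamma> n" "w \<in> H1 \<Gamma> n"
    using V W by (auto simp: VW V11_def H1_mean_zero_def)
  note L = H(1,2)[THEN H1_tangential_L2(1)[OF assms(1) n]] H(1,2)[THEN H1_tangential_L2(2)[OF assms(1) n]]
    H(3,4)[THEN H1_L2(2)]
  define a where "a = L2_norm \<Gamma> (covariant_gradient \<Gamma> n ww)"
  define b where "b = L2_norm \<Gamma> (weak_gradient \<Gamma> n w)"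
  define a' where "a' = L2_norm \<Gamma> (covariant_gradient \<Gamma> n vv)"
  define b' where "b' = L2_norm \<Gamma> (weak_gradient \<Gamma> n v)"
  define r where "r = Linf_norm \<Gamma> (ricci_map \<Gamma> n)"
  define M where "M = max 1 r"
  have nn: "0 \<le> a" "0 \<le> b" "0 \<le> a'" "0 \<le> b'" "0 \<le> r" "1 \<le> M" "r \<le> M" "0 < C_P"
    using P Linf_norm_bound(1)[OF assms(1) R]
    by (auto simp: a_def b_def a'_def b'_def r_def M_def L2_norm_nonneg poincare_constant_def)
  have poinc: "L2_norm \<Gamma> vv \<le> C_P * a'" "L2_norm \<Gamma> ww \<le> C_P * a"
    using P H by (auto simp: poincare_constant_def a_def a'_def)
  have 1: "\<bar>L2_inner \<Gamma> (covariant_gradient \<Gamma> n ww) (covariant_gradient \<Gamma> n vv)\<bar> \<le> a * a'"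
    unfolding a_def a'_def by (intro L2_Cauchy_Schwarz L)
  have 2: "\<bar>L2_inner \<Gamma> (weak_gradient \<Gamma> n w) (weak_gradient \<Gamma> n v)\<bar> \<le> b * b'"
    unfolding b_def b'_def by (intro L2_Cauchy_Schwarz L)
  have "\<bar>L2_inner \<Gamma> (weak_gradient \<Gamma> n w) vv\<bar> \<le> b * L2_norm \<Gamma> vv"
    unfolding b_def by (intro L2_Cauchy_Schwarz L)
  also have "\<dots> \<le> b * (C_P * a')" by (intro mult_left_mono poinc nn)
  also have "\<dots> \<le> M * (b * (C_P * a'))"
    using mult_right_mono[OF \<open>1 \<le> M\<close>, of "b * (C_P * a')"] nn by simp
  finally have 3: "\<bar>L2_inner \<Gamma> (weak_gradient \<Gamma> n w) vv\<bar> \<le> C_P * M * (b * a')"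
    by (simp add: mult_ac)
  have "\<bar>L2_inner \<Gamma> (\<lambda>x. ricci_map \<Gamma> n x *v ww x) (weak_gradient \<Gamma> n v)\<bar>
      \<le> L2_norm \<Gamma> (\<lambda>x. ricci_map \<Gamma> n x *v ww x) * b'"
    unfolding b'_def by (intro L2_Cauchy_Schwarz L Linf_norm_mult(1)[OF assms(1) R])
  also have "\<dots> \<le> (r * L2_norm \<Gamma> ww) * b'"
    unfolding r_def by (intro mult_right_mono Linf_norm_mult(2)[OF assms(1) R] L nn)
  also have "\<dots> \<le> (M * (C_P * a)) * b'"
    using nn by (intro mult_right_mono mult_mono poinc) (auto simp: L2_norm_nonneg)
  finally have 4: "\<bar>L2_inner \<Gamma> (\<lambda>x. ricci_map \<Gamma> n x *v ww x) (weak_gradient \<Gamma> n v)\<bar> \<le> C_P * M * (a * b')"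
    by (simp add: mult_ac)
  have norms: "norm11 \<Gamma> n W = sqrt (a\<^sup>2 + b\<^sup>2)" "norm11 \<Gamma> n V = sqrt (a'\<^sup>2 + b'\<^sup>2)"
    by (simp_all add: VW a_def b_def a'_def b'_def)
  have "\<bar>form_A \<Gamma> n W V\<bar> \<le> (a * a' + b * b') + C_P * M * (a * b' + b * a')"
    using 1 2 3 4 unfolding VW form_A.simps distrib_left by linarith
  also have "\<dots> \<le> norm11 \<Gamma> n W * norm11 \<Gamma> n V + C_P * M * (norm11 \<Gamma> n W * norm11 \<Gamma> n V)"
    using cauchy_schwarz_pair[of a a' b b'] cauchy_schwarz_pair[of a b' b a'] nn
    unfolding norms by (intro add_mono mult_left_mono) (auto simp: add.commute)
  also have "\<dots> = C_A \<Gamma> n C_P * norm11 \<Gamma> n W * norm11 \<Gamma> n V"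
    by (simp add: C_A_def M_def r_def algebra_simps)
  finally show ?thesis .
qed

text \<open>A tangential field satisfies \<open>w = P w\<close>, so on the diagonal the two coupling terms merge into
  one with the matrix \<open>P - R\<close>. Hence the Garding constant contains the norm of \<open>P - R\<close> and not the
  separate bounds of the two terms.\<close>

lemma form_A_coupling_eq:
  assumes "compact \<Gamma>" and n: "continuous_on \<Gamma> n" and R: "continuous_on \<Gamma> (ricci_map \<Gamma> n)"
    and ww: "ww \<in> H1_tangential \<Gamma> n" and g: "g \<in> L2 \<Gamma>"
  shows "L2_inner \<Gamma> g ww - L2_inner \<Gamma> (\<lambda>x. ricci_map \<Gamma> n x *v ww x) g
       = L2_inner \<Gamma> (\<lambda>x. (tangent_proj n x - ricci_map \<Gamma> n x) *v ww x) g"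
proof -
  let ?M = "surface_measure \<Gamma>"
  note L = H1_tangential_L2(1)[OF assms(1) n ww]
  note RL = Linf_norm_mult(1)[OF assms(1) R L]
  have "L2_inner \<Gamma> g ww - L2_inner \<Gamma> (\<lambda>x. ricci_map \<Gamma> n x *v ww x) g
      = (LINT x|?M. g x \<bullet> ww x - (ricci_map \<Gamma> n x *v ww x) \<bullet> g x)"
    unfolding L2_inner_def
    by (intro Bochner_Integration.integral_diff[symmetric] L2_integrable_inner L RL g)
  also have "\<dots> = L2_inner \<Gamma> (\<lambda>x. (tangent_proj n x - ricci_map \<Gamma> n x) *v ww x) g"
    unfolding L2_inner_def
  proof (rule integral_cong_AE)
    show "(\<lambda>x. g x \<bullet> ww x - (ricci_map \<Gamma> n x *v ww x) \<bullet> g x) \<in> borel_measurable ?M"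
      by (intro borel_measurable_diff borel_measurable_inner L2_measurable L RL g)
    show "(\<lambda>x. ((tangent_proj n x - ricci_map \<Gamma> n x) *v ww x) \<bullet> g x) \<in> borel_measurable ?M"
      by (intro borel_measurable_inner L2_measurable Linf_norm_mult(1)[OF assms(1) _ L]
          continuous_on_diff continuous_on_tangent_proj n R g)
    have "AE x in ?M. ww x \<bullet> n x = 0" using ww by (simp add: H1_tangential_def)
    then show "AE x in ?M. g x \<bullet> ww x - (ricci_map \<Gamma> n x *v ww x) \<bullet> g x
        = ((tangent_proj n x - ricci_map \<Gamma> n x) *v ww x) \<bullet> g x"
      by eventually_elim
         (simp add: matrix_vector_mult_diff_rdistrib tangent_proj_mult_tangential inner_diff_left
           inner_diff_right inner_commute)
  qed
  finally show ?thesis .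
qed

text \<open>By Young's inequality the merged coupling term is at least
  \<open>- 1/2 \<parallel>P - R\<parallel>\<^sub>\<infinity>\<^sup>2 \<parallel>w\<parallel>\<^sup>2 - 1/2 \<parallel>\<nabla> w\<parallel>\<^sup>2\<close>, where \<open>w\<close> is the vector
  component in \<open>\<parallel>w\<parallel>\<close> and the scalar component in \<open>\<parallel>\<nabla> w\<parallel>\<close>, and half of the scalar gradient term absorbs the last summand.\<close>

lemma form_A_Garding:
  assumes "compact \<Gamma>" and n: "continuous_on \<Gamma> n" and R: "continuous_on \<Gamma> (ricci_map \<Gamma> n)"
    and W: "W \<in> V11 \<Gamma> n"
  shows "c_A1 * (norm11 \<Gamma> n W)\<^sup>2 - c_A2 \<Gamma> n * (norm00 \<Gamma> W)\<^sup>2 \<le> form_A \<Gamma> n W W"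
proof -
  obtain ww w where Weq: "W = (ww, w)" by (cases W)
  have H: "ww \<in> H1_tangential \<Gamma> n" "w \<in> H1 \<Gamma> n"
    using W by (auto simp: Weq V11_def H1_mean_zero_def)
  note L = H1_tangential_L2[OF assms(1) n H(1)] H1_L2(2)[OF H(2)]
  define a where "a = L2_norm \<Gamma> (covariant_gradient \<Gamma> n ww)"
  define b where "b = L2_norm \<Gamma> (weak_gradient \<Gamma> n w)"
  define q where "q = Linf_norm \<Gamma> (\<lambda>x. tangent_proj n x - ricci_map \<Gamma> n x)"
  define z where "z = L2_norm \<Gamma> ww"
  let ?D = "\<lambda>x. (tangent_proj n x - ricci_map \<Gamma> n x) *v ww x"
  have D: "continuous_on \<Gamma> (\<lambda>x. tangent_proj n x - ricci_map \<Gamma> n x)"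
    by (intro continuous_on_diff continuous_on_tangent_proj n R)
  have form: "form_A \<Gamma> n W W = a\<^sup>2 + b\<^sup>2 + L2_inner \<Gamma> ?D (weak_gradient \<Gamma> n w)"
    using form_A_coupling_eq[OF assms(1) n R H(1) L(3)]
    by (simp add: Weq a_def b_def L2_norm_sq)
  have "\<bar>L2_inner \<Gamma> ?D (weak_gradient \<Gamma> n w)\<bar> \<le> L2_norm \<Gamma> ?D * b"
    unfolding b_def by (intro L2_Cauchy_Schwarz Linf_norm_mult(1)[OF assms(1) D] L)
  also have "\<dots> \<le> (q * z) * b"
    unfolding q_def z_def b_def by (intro mult_right_mono Linf_norm_mult(2)[OF assms(1) D] L L2_norm_nonneg)
  also have "\<dots> \<le> 1 / 2 * (q * z)\<^sup>2 + 1 / 2 * b\<^sup>2"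
    using sum_squares_bound[of "q * z" b] by simp
  finally have "- (1 / 2 * q\<^sup>2 * z\<^sup>2) - 1 / 2 * b\<^sup>2 \<le> L2_inner \<Gamma> ?D (weak_gradient \<Gamma> n w)"
    by (simp add: power_mult_distrib)
  moreover have "(norm11 \<Gamma> n W)\<^sup>2 = a\<^sup>2 + b\<^sup>2" by (simp add: Weq a_def b_def)
  moreover have "c_A2 \<Gamma> n * (norm00 \<Gamma> W)\<^sup>2 = 1 / 2 * q\<^sup>2 * z\<^sup>2 + 1 / 2 * q\<^sup>2 * (L2_norm \<Gamma> w)\<^sup>2"
    by (simp add: Weq c_A2_def q_def z_def algebra_simps)
  moreover have "0 \<le> q\<^sup>2 * (L2_norm \<Gamma> w)\<^sup>2" "0 \<le> a\<^sup>2" by simp_all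
  ultimately show ?thesis unfolding form c_A1_def by linarith
qed

lemma Linf_norm_eq_0_imp_AE:
  assumes "compact \<Gamma>" "continuous_on \<Gamma> A" "Linf_norm \<Gamma> A = 0"
  shows "AE x in surface_measure \<Gamma>. A x = 0"
  using Linf_norm_bound(2)[OF assms(1,2)]
proof eventually_elim
  case (elim x)
  then have "onorm ((*v) (A x)) = 0"
    using onorm_pos_le[OF matrix_vector_mul_bounded_linear, of "A x"] assms(3) by simp
  then have "A x *v y = 0 *v y" for y by (simp add: onorm_eq_0)
  then show ?case unfolding matrix_eq by blast
qed

theorem proposition3p6:
  fixes \<Gamma> :: "(real^'n) set"
    and n :: "real^'n \<Rightarrow> real^'n"
    and d :: nat
    and C_P :: real
  assumes "d \<ge> 2" and "CARD('n) = d + 1"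
    and "compact \<Gamma>" and "connected \<Gamma>" and "\<Gamma> \<noteq> {}"
    and "Ck_hypersurface 3 \<Gamma>"
    and "outward_unit_normal \<Gamma> n"
    and "poincare_constant \<Gamma> n C_P"
  shows "(\<forall>V\<in>V11 \<Gamma> n. \<forall>W\<in>V11 \<Gamma> n.
            \<bar>form_A \<Gamma> n W V\<bar> \<le> C_A \<Gamma> n C_P * norm11 \<Gamma> n W * norm11 \<Gamma> n V)
       \<and> (\<forall>W\<in>V11 \<Gamma> n.
            c_A1 * (norm11 \<Gamma> n W)\<^sup>2 - c_A2 \<Gamma> n * (norm00 \<Gamma> W)\<^sup>2 \<le> form_A \<Gamma> n W W)
       \<and> c_A1 > 0 \<and> C_A \<Gamma> n C_P > 0 \<and> c_A2 \<Gamma> n \<ge> 0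
       \<and> (\<not> (AE x in surface_measure \<Gamma>. tangent_proj n x = ricci_map \<Gamma> n x) \<longrightarrow> c_A2 \<Gamma> n > 0)"
proof -
  note cl = compact_imp_closed[OF \<open>compact \<Gamma>\<close>]
  note n = outward_normal_regular(1)[OF cl \<open>Ck_hypersurface 3 \<Gamma>\<close> \<open>outward_unit_normal \<Gamma> n\<close>]
  note R = continuous_on_ricci_map[OF cl \<open>Ck_hypersurface 3 \<Gamma>\<close> \<open>outward_unit_normal \<Gamma> n\<close>]
  have "0 < C_P" using \<open>poincare_constant \<Gamma> n C_P\<close> by (simp add: poincare_constant_def)
  then have "C_A \<Gamma> n C_P > 0" unfolding C_A_def by (intro add_pos_nonneg mult_nonneg_nonneg) auto
  moreover have "c_A2 \<Gamma> n > 0" if "\<not> (AE x in surface_measure \<Gamma>. tangent_proj n x = ricci_map \<Gamma> n x)"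
  proof -
    have "Linf_norm \<Gamma> (\<lambda>x. tangent_proj n x - ricci_map \<Gamma> n x) \<noteq> 0"
      using Linf_norm_eq_0_imp_AE[OF \<open>compact \<Gamma>\<close> continuous_on_diff[OF continuous_on_tangent_proj[OF n] R]] that
      by auto
    then show ?thesis by (simp add: c_A2_def)
  qed
  ultimately show ?thesis
    using form_A_continuous[OF \<open>compact \<Gamma>\<close> n R \<open>poincare_constant \<Gamma> n C_P\<close>]
      form_A_Garding[OF \<open>compact \<Gamma>\<close> n R]
    by (auto simp: c_A1_def c_A2_def)
qed

end
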